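(* Let $U\subset B_U$ and $V\subset B_V$ be open convex subsets of Banach spaces, equip $B_U\times B_V$ with the max norm, and let $Z$ be a Banach space. Let $r,s\ge0$ with $t=r-s>0$. Then the map $\phi\mapsto\hat\phi$, where $\hat\phi_u(x):=\phi(u,x)$ for $u\in U$, $x\in V$, defines canonical continuous linear injections \[C^r(U\times V;Z)\hookrightarrow C^t(U;C^s(V;Z))\quad\text{and}\quad c^r(U\times V;Z)\hookrightarrow C^t(U;c^s(V;Z)).\]
   Context: Fix $\delta_1\in(0,1]$. For $W$ an open convex subset of a Banach space, a Banach space $Y$, and $r=k+\alpha$ with $k\in\mathbb{N}_0$, $\alpha\in(0,1]$, $C^r(W;Y)$ is the space of $k$ times Fréchet differentiable $\phi:W\to Y$ with finite norm $\|\phi\|_r=\max_{0\le q\le k}\sup_W\|D^q\phi\|\vee h(\phi)$, where $h(\phi)$ is the smallest $C$ with $\|D^k\phi(\xi)-D^k\phi(\xi')\|\le C\|\xi-\xi'\|^\alpha$ whenever $\|\xi-\xi'\|\le\delta_1$; $C^0$ denotes bounded continuous maps with the sup norm. $c^r(W;Y)$ is the closure in $C^r(W;Y)$ of $C^{r'}(W;Y)$ for $r'>r$ (independent of $r'$). *)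

theory Defs
  imports "HOL-Analysis.Analysis" "HOL-Library.Function_Algebras"
begin

text \<open>Needed so that maps with values in a function space (such as C^s(V;Z))
can be treated with the generic Hoelder space definitions below.\<close>

instantiation "fun" :: (type, real_vector) real_vector
begin
definition scaleR_fun :: "real \<Rightarrow> ('a \<Rightarrow> 'b) \<Rightarrow> 'a \<Rightarrow> 'b"
  where "scaleR_fun c f = (\<lambda>x. c *\<^sub>R f x)"
instance
  by standard (auto simp: scaleR_fun_def fun_eq_iff scaleR_add_right scaleR_add_left
      plus_fun_def)
end

text \<open>Everything is relative to an explicitly given norm \<open>Na\<close> on the domain space
and a normed subspace (carrier \<open>S\<close>, norm \<open>Ny\<close>) of the target space.
Bounded q-multilinear maps are represented as functions on lists of length q.\<close>

definition multilinear_on :: "nat \<Rightarrow> ('a::real_vector list \<Rightarrow> 'y::real_vector) \<Rightarrow> bool" where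
  "multilinear_on q L \<longleftrightarrow>
     (\<forall>hs1 hs2 a b. length hs1 + length hs2 + 1 = q \<longrightarrow>
         L (hs1 @ (a + b) # hs2) = L (hs1 @ a # hs2) + L (hs1 @ b # hs2)) \<and>
     (\<forall>hs1 hs2 a (c::real). length hs1 + length hs2 + 1 = q \<longrightarrow>
         L (hs1 @ (c *\<^sub>R a) # hs2) = c *\<^sub>R L (hs1 @ a # hs2))"

definition ml_bounds :: "('a \<Rightarrow> real) \<Rightarrow> ('y \<Rightarrow> real) \<Rightarrow> nat \<Rightarrow> ('a list \<Rightarrow> 'y) \<Rightarrow> real set" where
  "ml_bounds Na Ny q L =
     {C. 0 \<le> C \<and> (\<forall>hs. length hs = q \<longrightarrow> Ny (L hs) \<le> C * prod_list (map Na hs))}"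

definition ml_norm :: "('a \<Rightarrow> real) \<Rightarrow> ('y \<Rightarrow> real) \<Rightarrow> nat \<Rightarrow> ('a list \<Rightarrow> 'y) \<Rightarrow> real" where
  "ml_norm Na Ny q L = Inf (ml_bounds Na Ny q L)"

definition bounded_ml :: "('a::real_vector \<Rightarrow> real) \<Rightarrow> 'y::real_vector set \<Rightarrow> ('y \<Rightarrow> real)
    \<Rightarrow> nat \<Rightarrow> ('a list \<Rightarrow> 'y) \<Rightarrow> bool" where
  "bounded_ml Na S Ny q L \<longleftrightarrow>
     (\<forall>hs. length hs = q \<longrightarrow> L hs \<in> S) \<and> multilinear_on q L \<and> ml_bounds Na Ny q L \<noteq> {}"

definition higher_derivs ::
  "('a::real_vector \<Rightarrow> real) \<Rightarrow> 'y::real_vector set \<Rightarrow> ('y \<Rightarrow> real) \<Rightarrow> 'a set \<Rightarrow> nat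
     \<Rightarrow> ('a \<Rightarrow> 'y) \<Rightarrow> (nat \<Rightarrow> 'a \<Rightarrow> 'a list \<Rightarrow> 'y) \<Rightarrow> bool" where
  "higher_derivs Na S Ny W k \<phi> D \<longleftrightarrow>
     (\<forall>x\<in>W. D 0 x [] = \<phi> x) \<and>
     (\<forall>q\<le>k. \<forall>x\<in>W. bounded_ml Na S Ny q (D q x)) \<and>
     (\<forall>q<k. \<forall>x\<in>W. \<forall>\<epsilon>>0. \<exists>\<delta>>0. \<forall>h. Na h < \<delta> \<and> x + h \<in> W \<longrightarrow>
        ml_norm Na Ny q (\<lambda>hs. D q (x + h) hs - D q x hs - D (Suc q) x (h # hs)) \<le> \<epsilon> * Na h)"

definition ord_k :: "real \<Rightarrow> nat" where
  "ord_k r = nat (\<lceil>r\<rceil> - 1)"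

definition ord_alpha :: "real \<Rightarrow> real" where
  "ord_alpha r = r - real (ord_k r)"

definition the_derivs where
  "the_derivs Na S Ny W k \<phi> = (SOME D. higher_derivs Na S Ny W k \<phi> D)"

definition sup_set :: "('a \<Rightarrow> real) \<Rightarrow> ('y \<Rightarrow> real) \<Rightarrow> 'a set \<Rightarrow> nat \<Rightarrow> ('a \<Rightarrow> 'a list \<Rightarrow> 'y) \<Rightarrow> real set" where
  "sup_set Na Ny W q Dq = (\<lambda>x. ml_norm Na Ny q (Dq x)) ` W"

definition hoelder_set :: "real \<Rightarrow> ('a::real_vector \<Rightarrow> real) \<Rightarrow> ('y::real_vector \<Rightarrow> real) \<Rightarrow> 'a set
    \<Rightarrow> nat \<Rightarrow> real \<Rightarrow> ('a \<Rightarrow> 'a list \<Rightarrow> 'y) \<Rightarrow> real set" where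
  "hoelder_set \<delta>1 Na Ny W k \<alpha> Dk =
     {ml_norm Na Ny k (\<lambda>hs. Dk \<xi> hs - Dk \<xi>' hs) / (Na (\<xi> - \<xi>') powr \<alpha>) | \<xi> \<xi>'.
        \<xi> \<in> W \<and> \<xi>' \<in> W \<and> \<xi> \<noteq> \<xi>' \<and> Na (\<xi> - \<xi>') \<le> \<delta>1}"

definition Cr ::
  "real \<Rightarrow> ('a::real_vector \<Rightarrow> real) \<Rightarrow> 'y::real_vector set \<Rightarrow> ('y \<Rightarrow> real) \<Rightarrow> 'a set
     \<Rightarrow> real \<Rightarrow> ('a \<Rightarrow> 'y) set" where
  "Cr \<delta>1 Na S Ny W r =
    (if r = 0 then
       {\<phi>. (\<forall>x\<in>W. \<phi> x \<in> S) \<and> bdd_above ((\<lambda>x. Ny (\<phi> x)) ` W) \<and>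
            (\<forall>x\<in>W. \<forall>\<epsilon>>0. \<exists>\<delta>>0. \<forall>y\<in>W. Na (y - x) < \<delta> \<longrightarrow> Ny (\<phi> y - \<phi> x) < \<epsilon>)}
     else
       {\<phi>. (\<forall>x\<in>W. \<phi> x \<in> S) \<and>
            (\<exists>D. higher_derivs Na S Ny W (ord_k r) \<phi> D \<and>
                 (\<forall>q\<le>ord_k r. bdd_above (sup_set Na Ny W q (D q))) \<and>
                 bdd_above (hoelder_set \<delta>1 Na Ny W (ord_k r) (ord_alpha r) (D (ord_k r))))})"

text \<open>The norm \<open>\<parallel>\<phi>\<parallel>_r\<close> (meaningful for \<open>\<phi> \<in> C^r\<close>).\<close>
definition Cr_norm ::
  "real \<Rightarrow> ('a::real_vector \<Rightarrow> real) \<Rightarrow> 'y::real_vector set \<Rightarrow> ('y \<Rightarrow> real) \<Rightarrow> 'a set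
     \<Rightarrow> real \<Rightarrow> ('a \<Rightarrow> 'y) \<Rightarrow> real" where
  "Cr_norm \<delta>1 Na S Ny W r \<phi> =
    (if r = 0 then Sup ({0} \<union> (\<lambda>x. Ny (\<phi> x)) ` W)
     else (let D = the_derivs Na S Ny W (ord_k r) \<phi> in
           Sup ({0} \<union> (\<Union>q\<in>{..ord_k r}. sup_set Na Ny W q (D q)) \<union>
                {Sup ({0} \<union> hoelder_set \<delta>1 Na Ny W (ord_k r) (ord_alpha r) (D (ord_k r)))})))"

definition cr ::
  "real \<Rightarrow> ('a::real_vector \<Rightarrow> real) \<Rightarrow> 'y::real_vector set \<Rightarrow> ('y \<Rightarrow> real) \<Rightarrow> 'a set
     \<Rightarrow> real \<Rightarrow> ('a \<Rightarrow> 'y) set" where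
  "cr \<delta>1 Na S Ny W r =
     {\<phi> \<in> Cr \<delta>1 Na S Ny W r. \<forall>\<epsilon>>0. \<exists>r'>r. \<exists>\<psi> \<in> Cr \<delta>1 Na S Ny W r'.
          Cr_norm \<delta>1 Na S Ny W r (\<lambda>x. \<phi> x - \<psi> x) < \<epsilon>}"

definition max_norm :: "'a::real_normed_vector \<times> 'b::real_normed_vector \<Rightarrow> real" where
  "max_norm p = max (norm (fst p)) (norm (snd p))"

definition curry_hat :: "('u \<times> 'v \<Rightarrow> 'z) \<Rightarrow> 'u \<Rightarrow> 'v \<Rightarrow> 'z" where
  "curry_hat \<phi> = (\<lambda>u x. \<phi> (u, x))"

end

theory Submission
  imports Defs
begin

text \<open>
  Slicing: the derivatives of \<open>\<phi>\<close>-hat in \<open>u\<close> are \<open>x \<mapsto> D^q \<phi>(u,x)\<close> applied to directions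
  \<open>(h,0)\<close>, and their derivatives in \<open>x\<close> are higher derivatives of \<open>\<phi>\<close> applied to mixed directions
  (this needs the symmetry of \<open>D^q \<phi>\<close>). Write \<open>s = l + \<beta>\<close> and \<open>t = m + \<gamma>\<close>, so that
  \<open>r = l + m + \<beta> + \<gamma>\<close>. The heart of the matter is that the mixed second difference of \<open>D^j \<phi>\<close> with
  increments \<open>a\<close>, \<open>b\<close> is bounded by \<open>2 \<parallel>\<phi>\<parallel>_r |a|^\<gamma> |b|^\<beta>\<close> as soon as \<open>j + \<beta> + \<gamma> \<le> r\<close>: with \<open>j = l + m\<close>
  this is the Hoelder condition of order \<open>\<gamma>\<close> in \<open>u\<close> for the \<open>\<beta>\<close>-Hoelder seminorm in \<open>x\<close>, and
  integrated once with \<open>j = l + q + 1\<close>, \<open>q < m\<close>, it bounds the Taylor remainders in \<open>C^s(V;Z)\<close>.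
  For the little spaces, an approximation of \<open>\<phi>\<close> by \<open>\<Psi> \<in> C^r'\<close> slices to an approximation by
  maps in \<open>C^(r'-t)\<close>, and \<open>r' - t > s\<close>.
\<close>

subsection \<open>Hoelder spaces relative to a seminormed target\<close>

lemma ml_norm_cong:
  assumes "\<And>hs. length hs = q \<Longrightarrow> Ny (L hs) = Ny (L' hs)"
  shows "ml_norm Na Ny q L = ml_norm Na Ny q L'"
  using assms by (simp add: ml_norm_def ml_bounds_def)

lemma ml_norm_le: "C \<in> ml_bounds Na Ny q L \<Longrightarrow> ml_norm Na Ny q L \<le> C"
  unfolding ml_norm_def by (rule cInf_lower) (auto simp: ml_bounds_def bdd_below_def)

lemma ord_k_0 [simp]: "ord_k 0 = 0"
  by (simp add: ord_k_def)

lemma ord_decomp: "r = real (ord_k r) + ord_alpha r"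
  by (simp add: ord_alpha_def)

text \<open>The ceiling in \<open>ord_k\<close> makes the exponent lie in (0,1], so an integer
  \<open>r\<close> splits as (r - 1) + 1 and its top seminorm is a Lipschitz constant.\<close>

lemma ord_alpha_bounds:
  assumes "0 < r"
  shows "0 < ord_alpha r" "ord_alpha r \<le> 1"
proof -
  have "1 \<le> \<lceil>r\<rceil>" using assms by linarith
  hence "real (ord_k r) = of_int \<lceil>r\<rceil> - 1" by (simp add: ord_k_def)
  thus "0 < ord_alpha r" "ord_alpha r \<le> 1"
    unfolding ord_alpha_def by linarith+
qed

lemma ord_k_mono: "r \<le> r' \<Longrightarrow> ord_k r \<le> ord_k r'"
  unfolding ord_k_def by (intro nat_mono diff_right_mono ceiling_mono)

text \<open>The locale serves twice: with target Z, and with target C^s(V;Z), whose elements are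
  total functions measured only on V. Hence \<open>Ny\<close> is a mere seminorm with laws asked for
  on \<open>S\<close> alone, whereas \<open>Na\<close> is a true norm. Openness is phrased through
  \<open>Na\<close>, since the max norm is not the type class norm of a product.\<close>

locale hoelder_space =
  fixes Na :: "'a::real_vector \<Rightarrow> real" and S :: "'y::real_vector set"
    and Ny :: "'y \<Rightarrow> real" and W :: "'a set"
  assumes Na_nonneg: "0 \<le> Na x"
    and Na_scale: "Na (c *\<^sub>R x) = \<bar>c\<bar> * Na x"
    and Na_add: "Na (x + x') \<le> Na x + Na x'"
    and Na_eq_0: "Na x = 0 \<Longrightarrow> x = 0"
    and subspace_S: "subspace S"
    and Ny_scale: "y \<in> S \<Longrightarrow> Ny (c *\<^sub>R y) = \<bar>c\<bar> * Ny y"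
    and Ny_add: "y \<in> S \<Longrightarrow> z \<in> S \<Longrightarrow> Ny (y + z) \<le> Ny y + Ny z"
    and W_open: "x \<in> W \<Longrightarrow> \<exists>\<delta>>0. \<forall>h. Na h < \<delta> \<longrightarrow> x + h \<in> W"
begin

abbreviation "P hs \<equiv> prod_list (map Na hs)"

lemma P_nonneg: "0 \<le> P hs"
  by (induction hs) (auto simp: Na_nonneg)

lemma Na_0 [simp]: "Na 0 = 0"
  using Na_scale[of 0 0] by simp

lemma Ny_0 [simp]: "Ny 0 = 0"
  using Ny_scale[of 0 0] subspace_0[OF subspace_S] by simp

lemma Ny_minus: "y \<in> S \<Longrightarrow> Ny (- y) = Ny y"
  using Ny_scale[of y "-1"] by simp

lemma Ny_nonneg: "y \<in> S \<Longrightarrow> 0 \<le> Ny y"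
  using Ny_add[of y "-y"] Ny_minus[of y] subspace_neg[OF subspace_S, of y] by simp

lemma Ny_diff: "y \<in> S \<Longrightarrow> z \<in> S \<Longrightarrow> Ny (y - z) \<le> Ny y + Ny z"
  using Ny_add[of y "-z"] Ny_minus[of z] subspace_neg[OF subspace_S, of z] by simp

lemma Ny_eqI:
  assumes "y \<in> S" "z \<in> S" "Ny (y - z) = 0"
  shows "Ny y = Ny z"
proof -
  have d: "y - z \<in> S" using assms subspace_diff[OF subspace_S] by blast
  have "Ny y \<le> Ny (y - z) + Ny z" using Ny_add[OF d assms(2)] by simp
  moreover have "Ny z \<le> Ny y + Ny (y - z)" using Ny_diff[OF assms(1) d] by simp
  ultimately show ?thesis using assms(3) by simp
qed

section \<open>Bounds of multilinear maps\<close>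

text \<open>The infimum is itself a bound: if \<open>P hs = 0\<close>, any member of
  \<open>ml_bounds\<close> already forces the left side to be at most 0; otherwise every member is
  at least the quotient by \<open>P hs\<close>, and so is the infimum.\<close>

lemma ml_norm_bound:
  assumes "ml_bounds Na Ny q L \<noteq> {}" "length hs = q"
  shows "Ny (L hs) \<le> ml_norm Na Ny q L * P hs"
proof (cases "P hs = 0")
  case True
  then show ?thesis using assms by (force simp: ml_bounds_def)
next
  case False
  hence pos: "0 < P hs" using P_nonneg[of hs] by simp
  have "Ny (L hs) / P hs \<le> ml_norm Na Ny q L"
    unfolding ml_norm_def
    by (rule cInf_greatest[OF assms(1)]) (use assms(2) pos in \<open>auto simp: ml_bounds_def divide_le_eq\<close>)
  thus ?thesis using pos by (simp add: divide_le_eq)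
qed

lemma ml_norm_le_iff:
  assumes "ml_bounds Na Ny q L \<noteq> {}" "0 \<le> c"
  shows "ml_norm Na Ny q L \<le> c \<longleftrightarrow> (\<forall>hs. length hs = q \<longrightarrow> Ny (L hs) \<le> c * P hs)"
proof
  assume "ml_norm Na Ny q L \<le> c"
  thus "\<forall>hs. length hs = q \<longrightarrow> Ny (L hs) \<le> c * P hs"
    using ml_norm_bound[OF assms(1)] mult_right_mono[OF _ P_nonneg] by (blast intro: order_trans)
next
  assume "\<forall>hs. length hs = q \<longrightarrow> Ny (L hs) \<le> c * P hs"
  thus "ml_norm Na Ny q L \<le> c" using assms(2) by (intro ml_norm_le) (auto simp: ml_bounds_def)
qed

lemma ml_bounds_diff:
  assumes "ml_bounds Na Ny q L \<noteq> {}" "ml_bounds Na Ny q M \<noteq> {}"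
    and "\<And>hs. length hs = q \<Longrightarrow> L hs \<in> S" "\<And>hs. length hs = q \<Longrightarrow> M hs \<in> S"
  shows "ml_bounds Na Ny q (\<lambda>hs. L hs - M hs) \<noteq> {}"
proof -
  obtain C D where C: "C \<in> ml_bounds Na Ny q L" and D: "D \<in> ml_bounds Na Ny q M"
    using assms(1,2) by auto
  have "Ny (L hs - M hs) \<le> (C + D) * P hs" if "length hs = q" for hs
  proof -
    have "Ny (L hs - M hs) \<le> Ny (L hs) + Ny (M hs)" by (intro Ny_diff assms that)
    also have "\<dots> \<le> C * P hs + D * P hs"
      using C D that by (auto simp: ml_bounds_def intro!: add_mono)
    finally show ?thesis by (simp add: algebra_simps)
  qed
  hence "C + D \<in> ml_bounds Na Ny q (\<lambda>hs. L hs - M hs)"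
    using C D by (auto simp: ml_bounds_def)
  thus ?thesis by blast
qed

lemma ml_bounds_tail:
  assumes "ml_bounds Na Ny (Suc q) L \<noteq> {}"
  shows "ml_bounds Na Ny q (\<lambda>hs. L (h # hs)) \<noteq> {}"
proof -
  obtain C where C: "C \<in> ml_bounds Na Ny (Suc q) L" using assms by auto
  have "Ny (L (h # hs)) \<le> (C * Na h) * P hs" if "length hs = q" for hs
    using C that by (auto simp: ml_bounds_def mult.assoc dest!: spec[of _ "h # hs"])
  hence "C * Na h \<in> ml_bounds Na Ny q (\<lambda>hs. L (h # hs))"
    using C by (auto simp: ml_bounds_def Na_nonneg)
  thus ?thesis by blast
qed

lemma higher_derivs_iff:

  \<comment> \<open>Derivative families and their uniqueness\<close>
  "higher_derivs Na S Ny W k \<phi> D \<longleftrightarrow>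
     (\<forall>x\<in>W. D 0 x [] = \<phi> x) \<and>
     (\<forall>q\<le>k. \<forall>x\<in>W. bounded_ml Na S Ny q (D q x)) \<and>
     (\<forall>q<k. \<forall>x\<in>W. \<forall>\<epsilon>>0. \<exists>\<delta>>0. \<forall>h. Na h < \<delta> \<and> x + h \<in> W \<longrightarrow>
        (\<forall>hs. length hs = q \<longrightarrow>
           Ny (D q (x + h) hs - D q x hs - D (Suc q) x (h # hs)) \<le> \<epsilon> * Na h * P hs))"
proof (cases "\<forall>q\<le>k. \<forall>x\<in>W. bounded_ml Na S Ny q (D q x)")
  case True
  have eq: "ml_norm Na Ny q (\<lambda>hs. D q (x + h) hs - D q x hs - D (Suc q) x (h # hs)) \<le> \<epsilon> * Na h \<longleftrightarrow>
     (\<forall>hs. length hs = q \<longrightarrow>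
           Ny (D q (x + h) hs - D q x hs - D (Suc q) x (h # hs)) \<le> \<epsilon> * Na h * P hs)"
    if "q < k" "x \<in> W" "x + h \<in> W" "0 < \<epsilon>" for q x h \<epsilon>
  proof (rule ml_norm_le_iff)
    have b: "bounded_ml Na S Ny q (D q (x + h))" "bounded_ml Na S Ny q (D q x)"
      "bounded_ml Na S Ny (Suc q) (D (Suc q) x)"
      using True that by auto
    show "ml_bounds Na Ny q (\<lambda>hs. D q (x + h) hs - D q x hs - D (Suc q) x (h # hs)) \<noteq> {}"
      using b by (intro ml_bounds_diff ml_bounds_tail subspace_diff[OF subspace_S])
        (auto simp: bounded_ml_def)
    show "0 \<le> \<epsilon> * Na h" using that Na_nonneg by simp
  qed
  show ?thesis unfolding higher_derivs_def using eq by meson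
next
  case False
  then show ?thesis unfolding higher_derivs_def by blast
qed

abbreviation "hders k \<phi> D \<equiv> higher_derivs Na S Ny W k \<phi> D"

lemma hders_0: "hders k \<phi> D \<Longrightarrow> x \<in> W \<Longrightarrow> D 0 x [] = \<phi> x"
  by (simp add: higher_derivs_def)

lemma hders_ml: "hders k \<phi> D \<Longrightarrow> q \<le> k \<Longrightarrow> x \<in> W \<Longrightarrow> bounded_ml Na S Ny q (D q x)"
  by (simp add: higher_derivs_def)

lemma hders_S: "hders k \<phi> D \<Longrightarrow> q \<le> k \<Longrightarrow> x \<in> W \<Longrightarrow> length hs = q \<Longrightarrow> D q x hs \<in> S"
  using hders_ml by (auto simp: bounded_ml_def)

lemma hders_bounds: "hders k \<phi> D \<Longrightarrow> q \<le> k \<Longrightarrow> x \<in> W \<Longrightarrow> ml_bounds Na Ny q (D q x) \<noteq> {}"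
  using hders_ml by (auto simp: bounded_ml_def)

lemma hders_scale:
  assumes "hders k \<phi> D" "q < k" "x \<in> W" "length hs = q"
  shows "D (Suc q) x ((c *\<^sub>R h) # hs) = c *\<^sub>R D (Suc q) x (h # hs)"
proof -
  have "multilinear_on (Suc q) (D (Suc q) x)"
    using hders_ml[OF assms(1), of "Suc q" x] assms by (auto simp: bounded_ml_def)
  thus ?thesis using assms(4) unfolding multilinear_on_def
    by (metis append_Nil list.size(3) add_0 Suc_eq_plus1)
qed

lemma hders_deriv:
  assumes "hders k \<phi> D" "q < k" "x \<in> W" "0 < \<epsilon>"
  obtains \<delta> where "0 < \<delta>" "\<And>h hs. Na h < \<delta> \<Longrightarrow> x + h \<in> W \<Longrightarrow> length hs = q \<Longrightarrow>
      Ny (D q (x + h) hs - D q x hs - D (Suc q) x (h # hs)) \<le> \<epsilon> * Na h * P hs"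
  using assms unfolding higher_derivs_iff by meson

text \<open>Since \<open>Ny\<close> may vanish off \<open>0\<close> (it ignores the values of a map off its domain), the derivatives
  are unique only up to \<open>Ny\<close>; this still makes \<open>Cr_norm\<close> independent of the choice in \<open>the_derivs\<close>.\<close>

lemma hders_unique:
  assumes D: "hders k \<phi> D" and E: "hders k \<phi> E"
  shows "q \<le> k \<Longrightarrow> x \<in> W \<Longrightarrow> length hs = q \<Longrightarrow> Ny (D q x hs - E q x hs) = 0"
proof (induction q arbitrary: x hs)
  case 0
  then show ?case using hders_0[OF D] hders_0[OF E] by simp
next
  case (Suc q)
  obtain h ks where hs: "hs = h # ks" "length ks = q" using Suc.prems(3) by (cases hs) auto
  have q: "q < k" "q \<le> k" using Suc.prems(1) by auto
  let ?d = "D (Suc q) x hs - E (Suc q) x hs"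
  have dS: "?d \<in> S"
    by (intro subspace_diff[OF subspace_S] hders_S[OF D] hders_S[OF E] Suc.prems)
  have "Ny ?d \<le> 0 + e" if "0 < e" for e
  proof -
    define \<epsilon> where "\<epsilon> = e / (2 * (Na h * P ks + 1))"
    have p: "0 \<le> Na h * P ks" by (simp add: Na_nonneg P_nonneg)
    have \<epsilon>: "0 < \<epsilon>" unfolding \<epsilon>_def using that p by simp
    obtain d1 where d1: "0 < d1" "\<And>h hs. Na h < d1 \<Longrightarrow> x + h \<in> W \<Longrightarrow> length hs = q \<Longrightarrow>
      Ny (D q (x + h) hs - D q x hs - D (Suc q) x (h # hs)) \<le> \<epsilon> * Na h * P hs"
      using hders_deriv[OF D q(1) Suc.prems(2) \<epsilon>] by blast
    obtain d2 where d2: "0 < d2" "\<And>h hs. Na h < d2 \<Longrightarrow> x + h \<in> W \<Longrightarrow> length hs = q \<Longrightarrow>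
      Ny (E q (x + h) hs - E q x hs - E (Suc q) x (h # hs)) \<le> \<epsilon> * Na h * P hs"
      using hders_deriv[OF E q(1) Suc.prems(2) \<epsilon>] by blast
    obtain d3 where d3: "0 < d3" "\<And>h. Na h < d3 \<Longrightarrow> x + h \<in> W"
      using W_open[OF Suc.prems(2)] by blast
    define d where "d = min d1 (min d2 d3)"
    have d: "0 < d" using d1 d2 d3 by (simp add: d_def)
    \<comment> \<open>Scaling \<open>h\<close> by \<open>c\<close> puts the increment inside all
      three radii; the summand 1 covers \<open>Na h = 0\<close>.\<close>
    define c where "c = d / (2 * (Na h + 1))"
    have c: "0 < c" using d Na_nonneg[of h] by (simp add: c_def)
    have "c * Na h < d"
    proof -
      have "c * Na h \<le> c * (Na h + 1)" using c by simp
      also have "\<dots> = d / 2" using Na_nonneg[of h] by (simp add: c_def field_simps)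
      finally show ?thesis using d by simp
    qed
    hence ch: "Na (c *\<^sub>R h) < d1" "Na (c *\<^sub>R h) < d2" "Na (c *\<^sub>R h) < d3"
      using c by (auto simp: Na_scale d_def)
    let ?y = "x + c *\<^sub>R h"
    have y: "?y \<in> W" using d3 ch by blast
    \<comment> \<open>\<open>?a\<close> and \<open>?b\<close> vanish under \<open>Ny\<close> by
      induction, while \<open>?u\<close> and \<open>?v\<close> are remainders with bounds
      proportional to \<open>c\<close>; dividing by \<open>c\<close> leaves an arbitrarily small
      bound on \<open>?d\<close>.\<close>
    let ?a = "D q ?y ks - E q ?y ks" and ?b = "D q x ks - E q x ks"
    let ?u = "D q ?y ks - D q x ks - D (Suc q) x ((c *\<^sub>R h) # ks)"
    let ?v = "E q ?y ks - E q x ks - E (Suc q) x ((c *\<^sub>R h) # ks)"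
    have l: "length ((c *\<^sub>R h) # ks) = Suc q" using hs by simp
    have inS: "D q ?y ks \<in> S" "E q ?y ks \<in> S" "D q x ks \<in> S" "E q x ks \<in> S"
       "D (Suc q) x ((c *\<^sub>R h) # ks) \<in> S" "E (Suc q) x ((c *\<^sub>R h) # ks) \<in> S"
      using hders_S[OF D q(2) y hs(2)] hders_S[OF E q(2) y hs(2)] hders_S[OF D q(2) Suc.prems(2) hs(2)]
        hders_S[OF E q(2) Suc.prems(2) hs(2)] hders_S[OF D Suc.prems(1,2) l] hders_S[OF E Suc.prems(1,2) l]
      by auto
    note sd = subspace_diff[OF subspace_S]
    have "c *\<^sub>R ?d = (?a - ?b) - (?u - ?v)"
      unfolding hs(1) scaleR_diff_right hders_scale[OF D q(1) Suc.prems(2) hs(2), symmetric]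
        hders_scale[OF E q(1) Suc.prems(2) hs(2), symmetric]
      by (simp add: algebra_simps)
    hence "c * Ny ?d = Ny ((?a - ?b) - (?u - ?v))"
      using Ny_scale[OF dS, of c] c by simp
    also have "\<dots> \<le> (Ny ?a + Ny ?b) + (Ny ?u + Ny ?v)"
      by (intro order_trans[OF Ny_diff] add_mono Ny_diff sd inS)
    also have "\<dots> \<le> (0 + 0) + (\<epsilon> * Na (c *\<^sub>R h) * P ks + \<epsilon> * Na (c *\<^sub>R h) * P ks)"
      using Suc.IH[OF q(2) y hs(2)] Suc.IH[OF q(2) Suc.prems(2) hs(2)]
      by (intro add_mono d1(2) d2(2) ch y hs(2)) auto
    also have "\<dots> = c * (2 * \<epsilon> * (Na h * P ks))" using c by (simp add: Na_scale)
    finally have "Ny ?d \<le> 2 * \<epsilon> * (Na h * P ks)" using c by simp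
    also have "\<dots> \<le> 2 * \<epsilon> * (Na h * P ks + 1)" using \<epsilon> by simp
    also have "\<dots> = e" unfolding \<epsilon>_def using p by (simp add: field_simps)
    finally show ?thesis by simp
  qed
  hence "Ny ?d \<le> 0" by (rule field_le_epsilon)
  thus ?case using Ny_nonneg[OF dS] by simp
qed

lemma hders_unique_Ny:
  assumes D: "hders k \<phi> D" and E: "hders k \<phi> E" and "q \<le> k" "x \<in> W" "length hs = q"
  shows "Ny (D q x hs) = Ny (E q x hs)"
  by (rule Ny_eqI[OF hders_S[OF D] hders_S[OF E] hders_unique[OF D E]]) (use assms in auto)

lemma hders_unique_Ny_diff:
  assumes D: "hders k \<phi> D" and E: "hders k \<phi> E" and "q \<le> k" "x \<in> W" "y \<in> W" "length hs = q"
  shows "Ny (D q x hs - D q y hs) = Ny (E q x hs - E q y hs)"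
proof (rule Ny_eqI)
  note sd = subspace_diff[OF subspace_S] and s = hders_S[OF D] hders_S[OF E]
  show *: "D q x hs - D q y hs \<in> S" "E q x hs - E q y hs \<in> S"
    using assms by (auto intro!: sd s)
  have s': "D q x hs - E q x hs \<in> S" "D q y hs - E q y hs \<in> S"
    using assms by (auto intro!: sd s)
  have "Ny ((D q x hs - E q x hs) - (D q y hs - E q y hs)) \<le> 0"
    using Ny_diff[OF s'] hders_unique[OF D E assms(3,4,6)] hders_unique[OF D E assms(3,5,6)] by simp
  moreover have "0 \<le> Ny ((D q x hs - D q y hs) - (E q x hs - E q y hs))"
    by (intro Ny_nonneg sd *)
  ultimately show "Ny ((D q x hs - D q y hs) - (E q x hs - E q y hs)) = 0"
    by (simp add: algebra_simps)
qed

lemma sup_set_unique: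
  assumes D: "hders k \<phi> D" and E: "hders k \<phi> E" and "q \<le> k"
  shows "sup_set Na Ny W q (D q) = sup_set Na Ny W q (E q)"
  unfolding sup_set_def
  by (intro image_cong refl ml_norm_cong hders_unique_Ny[OF D E] assms)

lemma hoelder_set_unique:
  assumes D: "hders k \<phi> D" and E: "hders k \<phi> E"
  shows "hoelder_set \<delta>1 Na Ny W k \<alpha> (D k) = hoelder_set \<delta>1 Na Ny W k \<alpha> (E k)"
proof -
  have "ml_norm Na Ny k (\<lambda>hs. D k \<xi> hs - D k \<xi>' hs) = ml_norm Na Ny k (\<lambda>hs. E k \<xi> hs - E k \<xi>' hs)"
    if "\<xi> \<in> W" "\<xi>' \<in> W" for \<xi> \<xi>'
    by (intro ml_norm_cong hders_unique_Ny_diff[OF D E] that) auto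
  hence "(b = ml_norm Na Ny k (\<lambda>hs. D k \<xi> hs - D k \<xi>' hs) / (Na (\<xi> - \<xi>') powr \<alpha>) \<and>
        \<xi> \<in> W \<and> \<xi>' \<in> W \<and> \<xi> \<noteq> \<xi>' \<and> Na (\<xi> - \<xi>') \<le> \<delta>1) \<longleftrightarrow>
      (b = ml_norm Na Ny k (\<lambda>hs. E k \<xi> hs - E k \<xi>' hs) / (Na (\<xi> - \<xi>') powr \<alpha>) \<and>
        \<xi> \<in> W \<and> \<xi>' \<in> W \<and> \<xi> \<noteq> \<xi>' \<and> Na (\<xi> - \<xi>') \<le> \<delta>1)" for b \<xi> \<xi>'
    by auto
  thus ?thesis unfolding hoelder_set_def by (simp only:)
qed

section \<open>The Hoelder norm through pointwise bounds\<close>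

text \<open>The inequality "norm of order r at most B" spelled out without suprema. At
  \<open>r = 0\<close> the exponent is 0, and the Hoelder clause would demand an oscillation of at
  most \<open>B\<close>, where the sup norm only gives \<open>2 * B\<close>.\<close>

definition Cbound :: "real \<Rightarrow> real \<Rightarrow> (nat \<Rightarrow> 'a \<Rightarrow> 'a list \<Rightarrow> 'y) \<Rightarrow> real \<Rightarrow> bool" where
  "Cbound \<delta>1 r D B \<longleftrightarrow>
     (\<forall>q\<le>ord_k r. \<forall>x\<in>W. \<forall>hs. length hs = q \<longrightarrow> Ny (D q x hs) \<le> B * P hs) \<and>
     (r \<noteq> 0 \<longrightarrow> (\<forall>x\<in>W. \<forall>y\<in>W. Na (x - y) \<le> \<delta>1 \<longrightarrow> (\<forall>hs. length hs = ord_k r \<longrightarrow>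
        Ny (D (ord_k r) x hs - D (ord_k r) y hs) \<le> B * Na (x - y) powr ord_alpha r * P hs)))"

lemma CboundD:
  assumes "Cbound \<delta>1 r D B"
  shows "q \<le> ord_k r \<Longrightarrow> x \<in> W \<Longrightarrow> length hs = q \<Longrightarrow> Ny (D q x hs) \<le> B * P hs"
    and "r \<noteq> 0 \<Longrightarrow> x \<in> W \<Longrightarrow> y \<in> W \<Longrightarrow> Na (x - y) \<le> \<delta>1 \<Longrightarrow> length hs = ord_k r \<Longrightarrow>
       Ny (D (ord_k r) x hs - D (ord_k r) y hs) \<le> B * Na (x - y) powr ord_alpha r * P hs"
  using assms unfolding Cbound_def by blast+

lemma Na_diff_pos: "x \<noteq> y \<Longrightarrow> 0 < Na (x - y)"
  using Na_eq_0[of "x - y"] Na_nonneg[of "x - y"] by fastforce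

lemma Cbound_sup:
  assumes "Cbound \<delta>1 r D B" "0 \<le> B" "q \<le> ord_k r" "b \<in> sup_set Na Ny W q (D q)"
  shows "b \<le> B"
  using assms by (auto simp: sup_set_def ml_bounds_def intro!: ml_norm_le CboundD(1))

lemma Cbound_hoelder:
  assumes "Cbound \<delta>1 r D B" "0 \<le> B" "r \<noteq> 0"
    and b: "b \<in> hoelder_set \<delta>1 Na Ny W (ord_k r) (ord_alpha r) (D (ord_k r))"
  shows "b \<le> B"
proof -
  obtain x y where xy: "x \<in> W" "y \<in> W" "x \<noteq> y" "Na (x - y) \<le> \<delta>1"
    "b = ml_norm Na Ny (ord_k r) (\<lambda>hs. D (ord_k r) x hs - D (ord_k r) y hs) / (Na (x - y) powr ord_alpha r)"
    using b by (auto simp: hoelder_set_def)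
  have "ml_norm Na Ny (ord_k r) (\<lambda>hs. D (ord_k r) x hs - D (ord_k r) y hs) \<le> B * Na (x - y) powr ord_alpha r"
    using CboundD(2)[OF assms(1,3) xy(1,2,4)] assms(2)
    by (intro ml_norm_le) (auto simp: ml_bounds_def)
  thus ?thesis using Na_diff_pos[OF xy(3)] by (simp add: xy(5) divide_le_eq)
qed

lemma CrI:
  assumes "r \<noteq> 0" "hders (ord_k r) \<phi> D" "Cbound \<delta>1 r D B" "0 \<le> B"
  shows "\<phi> \<in> Cr \<delta>1 Na S Ny W r"
proof -
  have "\<phi> x \<in> S" if "x \<in> W" for x
    using hders_0[OF assms(2) that] hders_S[OF assms(2) _ that, of 0 "[]"] by simp
  moreover have "bdd_above (sup_set Na Ny W q (D q))" if "q \<le> ord_k r" for q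
    using Cbound_sup[OF assms(3,4) that] by (rule bdd_aboveI)
  moreover have "bdd_above (hoelder_set \<delta>1 Na Ny W (ord_k r) (ord_alpha r) (D (ord_k r)))"
    using Cbound_hoelder[OF assms(3,4,1)] by (rule bdd_aboveI)
  ultimately show ?thesis using assms(1,2) by (auto simp: Cr_def)
qed

text \<open>For \<open>r = 0\<close> the values of \<phi>, read as 0-linear maps, form the family;
  this lets the case \<open>s = 0\<close> share the later arguments.\<close>

lemma Cr_hders_ex:
  assumes "\<phi> \<in> Cr \<delta>1 Na S Ny W r"
  obtains D where "hders (ord_k r) \<phi> D"
proof (cases "r = 0")
  case True
  hence S: "\<And>x. x \<in> W \<Longrightarrow> \<phi> x \<in> S" using assms by (simp add: Cr_def)
  have "bounded_ml Na S Ny 0 (\<lambda>_. \<phi> x)" if "x \<in> W" for x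
    unfolding bounded_ml_def multilinear_on_def ml_bounds_def
    using S[OF that] Ny_nonneg[OF S[OF that]] by auto
  hence "hders 0 \<phi> (\<lambda>_ x _. \<phi> x)" by (simp add: higher_derivs_def)
  thus ?thesis using that True by simp
next
  case False
  thus ?thesis using that assms by (auto simp: Cr_def)
qed

lemma Cr_bdd:
  assumes "\<phi> \<in> Cr \<delta>1 Na S Ny W r" "r \<noteq> 0" and D: "hders (ord_k r) \<phi> D"
  shows "q \<le> ord_k r \<Longrightarrow> bdd_above (sup_set Na Ny W q (D q))"
    and "bdd_above (hoelder_set \<delta>1 Na Ny W (ord_k r) (ord_alpha r) (D (ord_k r)))"
proof -
  obtain E where E: "hders (ord_k r) \<phi> E" "\<And>q. q \<le> ord_k r \<Longrightarrow> bdd_above (sup_set Na Ny W q (E q))"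
     "bdd_above (hoelder_set \<delta>1 Na Ny W (ord_k r) (ord_alpha r) (E (ord_k r)))"
    using assms by (auto simp: Cr_def)
  show "q \<le> ord_k r \<Longrightarrow> bdd_above (sup_set Na Ny W q (D q))"
    using E(2) sup_set_unique[OF D E(1)] by simp
  show "bdd_above (hoelder_set \<delta>1 Na Ny W (ord_k r) (ord_alpha r) (D (ord_k r)))"
    using E(3) hoelder_set_unique[OF D E(1)] by simp
qed

lemma Cr_norm_eq:
  assumes "r \<noteq> 0" and D: "hders (ord_k r) \<phi> D"
  shows "Cr_norm \<delta>1 Na S Ny W r \<phi> =
     Sup ({0} \<union> (\<Union>q\<in>{..ord_k r}. sup_set Na Ny W q (D q)) \<union>
          {Sup ({0} \<union> hoelder_set \<delta>1 Na Ny W (ord_k r) (ord_alpha r) (D (ord_k r)))})"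
proof -
  let ?E = "the_derivs Na S Ny W (ord_k r) \<phi>"
  have E: "hders (ord_k r) \<phi> ?E"
    unfolding the_derivs_def by (rule someI[of _ D]) (rule D)
  have "(\<Union>q\<in>{..ord_k r}. sup_set Na Ny W q (?E q)) = (\<Union>q\<in>{..ord_k r}. sup_set Na Ny W q (D q))"
    using sup_set_unique[OF E D] by auto
  thus ?thesis
    using assms(1) unfolding Cr_norm_def Let_def hoelder_set_unique[OF E D] by simp
qed

lemma Cr_norm_le:
  assumes D: "hders (ord_k r) \<phi> D" and B: "Cbound \<delta>1 r D B" "0 \<le> B"
  shows "Cr_norm \<delta>1 Na S Ny W r \<phi> \<le> B"
proof (cases "r = 0")
  case True
  have "Ny (\<phi> x) \<le> B" if "x \<in> W" for x
    using CboundD(1)[OF B(1), of 0 x "[]"] hders_0[OF D that] that by simp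
  thus ?thesis using True B(2) by (auto simp: Cr_norm_def intro!: cSup_least)
next
  case False
  have "Sup ({0} \<union> hoelder_set \<delta>1 Na Ny W (ord_k r) (ord_alpha r) (D (ord_k r))) \<le> B"
    using Cbound_hoelder[OF B False] B(2) by (intro cSup_least) auto
  thus ?thesis unfolding Cr_norm_eq[OF False D]
    using B(2) Cbound_sup[OF B] by (intro cSup_least) auto
qed

lemma Cr_norm_nonneg:
  assumes "\<phi> \<in> Cr \<delta>1 Na S Ny W r"
  shows "0 \<le> Cr_norm \<delta>1 Na S Ny W r \<phi>"
proof (cases "r = 0")
  case True
  thus ?thesis using assms by (auto simp: Cr_def Cr_norm_def intro!: cSup_upper)
next
  case False
  obtain D where D: "hders (ord_k r) \<phi> D" using Cr_hders_ex[OF assms] by blast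
  show ?thesis unfolding Cr_norm_eq[OF False D]
    using Cr_bdd(1)[OF assms False D] by (intro cSup_upper) auto
qed

text \<open>Converse of \<open>Cr_norm_le\<close>: together they make \<open>Cr_norm\<close> the
  least nonnegative constant in \<open>Cbound\<close>. Membership in \<open>Cr\<close> bounds the
  sets from above, without which \<open>Sup\<close> carries no information.\<close>

lemma Cbound_Cr_norm:
  assumes \<phi>: "\<phi> \<in> Cr \<delta>1 Na S Ny W r" and D: "hders (ord_k r) \<phi> D"
  shows "Cbound \<delta>1 r D (Cr_norm \<delta>1 Na S Ny W r \<phi>)"
proof (cases "r = 0")
  case True
  have b: "bdd_above ((\<lambda>x. Ny (\<phi> x)) ` W)" using \<phi> True by (simp add: Cr_def)
  have "Ny (D 0 x []) \<le> Sup ({0} \<union> (\<lambda>x. Ny (\<phi> x)) ` W)" if "x \<in> W" for x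
    unfolding hders_0[OF D that] using b that by (intro cSup_upper) auto
  thus ?thesis using True by (auto simp: Cbound_def Cr_norm_def)
next
  case False
  let ?H = "hoelder_set \<delta>1 Na Ny W (ord_k r) (ord_alpha r) (D (ord_k r))"
  let ?A = "{0} \<union> (\<Union>q\<in>{..ord_k r}. sup_set Na Ny W q (D q)) \<union> {Sup ({0} \<union> ?H)}"
  note N = Cr_norm_eq[OF False D, of \<delta>1]
  have bH: "bdd_above ({0} \<union> ?H)" using Cr_bdd(2)[OF \<phi> False D] by simp
  have bA: "bdd_above ?A" using Cr_bdd(1)[OF \<phi> False D] by auto
  show ?thesis unfolding Cbound_def
  proof (intro conjI allI ballI impI)
    fix q x and hs :: "'a list" assume *: "q \<le> ord_k r" "x \<in> W" "length hs = q"
    have "ml_norm Na Ny q (D q x) \<le> Cr_norm \<delta>1 Na S Ny W r \<phi>"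
      unfolding N using * by (intro cSup_upper[OF _ bA]) (auto simp: sup_set_def)
    thus "Ny (D q x hs) \<le> Cr_norm \<delta>1 Na S Ny W r \<phi> * P hs"
      using ml_norm_bound[OF hders_bounds[OF D *(1,2)] *(3)] P_nonneg
      by (meson mult_right_mono order_trans)
  next
    fix x y and hs :: "'a list"
    assume *: "x \<in> W" "y \<in> W" "Na (x - y) \<le> \<delta>1" "length hs = ord_k r"
    let ?L = "\<lambda>hs. D (ord_k r) x hs - D (ord_k r) y hs"
    show "Ny (D (ord_k r) x hs - D (ord_k r) y hs)
           \<le> Cr_norm \<delta>1 Na S Ny W r \<phi> * Na (x - y) powr ord_alpha r * P hs"
    proof (cases "x = y")
      case ne: False
      have "ml_norm Na Ny (ord_k r) ?L / (Na (x - y) powr ord_alpha r) \<le> Sup ({0} \<union> ?H)"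
        using * ne by (intro cSup_upper[OF _ bH]) (auto simp: hoelder_set_def)
      also have "\<dots> \<le> Cr_norm \<delta>1 Na S Ny W r \<phi>"
        unfolding N by (intro cSup_upper[OF _ bA]) auto
      finally have le: "ml_norm Na Ny (ord_k r) ?L \<le> Cr_norm \<delta>1 Na S Ny W r \<phi> * Na (x - y) powr ord_alpha r"
        using Na_diff_pos[OF ne] by (simp add: divide_le_eq)
      have "ml_bounds Na Ny (ord_k r) ?L \<noteq> {}"
        using * by (intro ml_bounds_diff hders_bounds[OF D] hders_S[OF D]) auto
      from ml_norm_bound[OF this *(4)] show ?thesis
        using mult_right_mono[OF le P_nonneg[of hs]] by simp
    qed simp
  qed
qed

end

subsection \<open>Taylor estimates for Hoelder families\<close>

text \<open>The mean value inequality takes the place of integration along segments in all estimates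
  below.\<close>

lemma mvt_unit_interval:
  fixes f :: "real \<Rightarrow> 'z::real_normed_vector"
  assumes "\<And>t. t \<in> {0..1} \<Longrightarrow> (f has_vector_derivative f' t) (at t within {0..1})"
    and "\<And>t. t \<in> {0..1} \<Longrightarrow> norm (f' t) \<le> M"
  shows "norm (f 1 - f 0) \<le> M"
proof -
  have "onorm (\<lambda>x. x *\<^sub>R f' t) \<le> M" if "t \<in> {0..1}" for t
  proof (rule onorm_bound)
    show "0 \<le> M" using assms(2)[OF that] norm_ge_zero order_trans by blast
    show "norm (x *\<^sub>R f' t) \<le> M * norm x" for x
      using mult_left_mono[OF assms(2)[OF that], of "\<bar>x\<bar>"] by (simp add: mult.commute)
  qed
  hence "norm (f 1 - f 0) \<le> M * norm (1 - 0 :: real)"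
    using assms(1) unfolding has_vector_derivative_def
    by (intro differentiable_bound[of "{0..1}" f "\<lambda>t x. x *\<^sub>R f' t"]) auto
  thus ?thesis by simp
qed

locale normed_target =
  hoelder_space Na "UNIV :: 'z::real_normed_vector set" norm W
  for Na :: "'a::real_vector \<Rightarrow> real" and W :: "'a set" +
  fixes target :: "'z::real_normed_vector itself" \<comment> \<open>fixes the target type, which no other parameter mentions\<close>
  assumes convex_W: "convex W"
begin

lemma segment_in_W:
  assumes "x \<in> W" "x + h \<in> W" "t \<in> {0..1}"
  shows "x + t *\<^sub>R h \<in> W"
proof -
  have "(1 - t) *\<^sub>R x + t *\<^sub>R (x + h) \<in> W"
    using assms by (intro convexD[OF convex_W]) auto
  thus ?thesis by (simp add: algebra_simps)
qed

lemma hders_ml_add: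
  assumes "hders k \<phi> D" "q < k" "x \<in> W" "length hs = q"
  shows "D (Suc q) x ((a + b) # hs) = D (Suc q) x (a # hs) + D (Suc q) x (b # hs)"
proof -
  have "multilinear_on (Suc q) (D (Suc q) x)"
    using hders_ml[OF assms(1), of "Suc q" x] assms by (auto simp: bounded_ml_def)
  thus ?thesis using assms(4) unfolding multilinear_on_def
    by (metis append_Nil list.size(3) add_0 Suc_eq_plus1)
qed

lemma hders_ml_scale2:
  assumes "hders k \<phi> D" "Suc q < k" "x \<in> W" "length hs = q"
  shows "D (Suc (Suc q)) x (a # (c *\<^sub>R b) # hs) = c *\<^sub>R D (Suc (Suc q)) x (a # b # hs)"
proof -
  have "multilinear_on (Suc (Suc q)) (D (Suc (Suc q)) x)"
    using hders_ml[OF assms(1), of "Suc (Suc q)" x] assms by (auto simp: bounded_ml_def)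
  hence "\<forall>hs1 hs2 a (c::real). length hs1 + length hs2 + 1 = Suc (Suc q) \<longrightarrow>
      D (Suc (Suc q)) x (hs1 @ (c *\<^sub>R a) # hs2) = c *\<^sub>R D (Suc (Suc q)) x (hs1 @ a # hs2)"
    by (simp add: multilinear_on_def)
  from this[rule_format, of "[a]" hs c b] show ?thesis using assms(4) by simp
qed

text \<open>Restriction to a segment turns the Frechet derivative relative to \<open>Na\<close> into
  an ordinary vector derivative, to which the mean value inequality applies.\<close>

lemma hders_directional:
  assumes D: "hders k \<phi> D" and q: "q < k" and x: "x \<in> W" "x + h \<in> W" and hs: "length hs = q"
    and t: "t \<in> {0..1}"
  shows "((\<lambda>t. D q (x + t *\<^sub>R h) hs) has_vector_derivative D (Suc q) (x + t *\<^sub>R h) (h # hs))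
           (at t within {0..1})"
  unfolding has_vector_derivative_def has_derivative_within_alt
proof (intro conjI allI impI)
  let ?y = "x + t *\<^sub>R h"
  have y: "?y \<in> W" using segment_in_W x t by blast
  show "bounded_linear (\<lambda>s. s *\<^sub>R D (Suc q) ?y (h # hs))" by (rule bounded_linear_scaleR_left)
  fix e :: real assume e: "0 < e"
  have p: "0 \<le> Na h * P hs" by (simp add: Na_nonneg P_nonneg)
  define \<epsilon> where "\<epsilon> = e / (Na h * P hs + 1)"
  have \<epsilon>: "0 < \<epsilon>" using e p by (simp add: \<epsilon>_def)
  have \<epsilon>': "\<epsilon> * (Na h * P hs) \<le> e"
  proof -
    have "\<epsilon> * (Na h * P hs) \<le> \<epsilon> * (Na h * P hs + 1)" using \<epsilon> by simp
    also have "\<dots> = e" using p by (simp add: \<epsilon>_def field_simps)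
    finally show ?thesis .
  qed
  obtain \<delta> where \<delta>: "0 < \<delta>" "\<And>h hs. Na h < \<delta> \<Longrightarrow> ?y + h \<in> W \<Longrightarrow> length hs = q \<Longrightarrow>
      norm (D q (?y + h) hs - D q ?y hs - D (Suc q) ?y (h # hs)) \<le> \<epsilon> * Na h * P hs"
    using hders_deriv[OF D q y \<epsilon>] by blast
  show "\<exists>d>0. \<forall>s\<in>{0..1}. norm (s - t) < d \<longrightarrow>
      norm (D q (x + s *\<^sub>R h) hs - D q ?y hs - (s - t) *\<^sub>R D (Suc q) ?y (h # hs)) \<le> e * norm (s - t)"
  proof (intro exI[of _ "\<delta> / (Na h + 1)"] conjI ballI impI)
    show "0 < \<delta> / (Na h + 1)" using \<delta> Na_nonneg[of h] by simp
    fix s :: real assume s: "s \<in> {0..1}" "norm (s - t) < \<delta> / (Na h + 1)"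
    have eq: "?y + (s - t) *\<^sub>R h = x + s *\<^sub>R h" by (simp add: algebra_simps)
    have "\<bar>s - t\<bar> * Na h \<le> \<bar>s - t\<bar> * (Na h + 1)" by (simp add: mult_left_mono)
    also have "\<dots> < \<delta>" using s(2) Na_nonneg[of h] by (simp add: pos_less_divide_eq add_nonneg_pos)
    finally have "Na ((s - t) *\<^sub>R h) < \<delta>" by (simp add: Na_scale)
    moreover have "?y + (s - t) *\<^sub>R h \<in> W" unfolding eq using segment_in_W x s(1) by blast
    ultimately have "norm (D q (x + s *\<^sub>R h) hs - D q ?y hs - (s - t) *\<^sub>R D (Suc q) ?y (h # hs))
        \<le> \<epsilon> * Na ((s - t) *\<^sub>R h) * P hs"
      using \<delta>(2)[OF _ _ hs, of "(s - t) *\<^sub>R h"] unfolding eq hders_scale[OF D q y hs] by blast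
    also have "\<dots> = \<epsilon> * (Na h * P hs) * norm (s - t)" by (simp add: Na_scale)
    also have "\<dots> \<le> e * norm (s - t)" using \<epsilon>' by (intro mult_right_mono) auto
    finally show "norm (D q (x + s *\<^sub>R h) hs - D q ?y hs - (s - t) *\<^sub>R D (Suc q) ?y (h # hs))
       \<le> e * norm (s - t)" .
  qed
qed

text \<open>Two functions equal on \<open>W\<close> have equal derivatives. The direction
  \<open>d\<close> is shrunk until the segment stays in \<open>W\<close>, the one-sided derivatives
  at 0 are compared, and homogeneity in the first slot removes the factor \<open>c\<close>.\<close>

lemma hders_front_cong:
  assumes D: "hders k \<phi> D" and n: "n < k" and l: "length l = n" "length l' = n"
    and eq: "\<And>x. x \<in> W \<Longrightarrow> D n x l = D n x l'" and x: "x \<in> W"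
  shows "D (Suc n) x (d # l) = D (Suc n) x (d # l')"
proof -
  obtain \<delta> where \<delta>: "0 < \<delta>" "\<And>h. Na h < \<delta> \<Longrightarrow> x + h \<in> W" using W_open[OF x] by blast
  define c where "c = \<delta> / (2 * (Na d + 1))"
  have c: "0 < c" using \<delta> Na_nonneg[of d] by (simp add: c_def)
  have "c * Na d \<le> c * (Na d + 1)" using c by simp
  also have "\<dots> = \<delta> / 2" using Na_nonneg[of d] by (simp add: c_def field_simps)
  finally have "x + c *\<^sub>R d \<in> W" using \<delta> c by (intro \<delta>) (simp add: Na_scale)
  note x' = x this
  have "((\<lambda>t. D n (x + t *\<^sub>R (c *\<^sub>R d)) l) has_vector_derivative D (Suc n) (x + 0 *\<^sub>R (c *\<^sub>R d)) ((c *\<^sub>R d) # l))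
           (at 0 within {0..1})"
    by (rule hders_directional[OF D n x' l(1)]) simp
  moreover have "((\<lambda>t. D n (x + t *\<^sub>R (c *\<^sub>R d)) l) has_vector_derivative D (Suc n) (x + 0 *\<^sub>R (c *\<^sub>R d)) ((c *\<^sub>R d) # l'))
           (at 0 within {0..1})"
    by (rule has_vector_derivative_transform[OF _ _ hders_directional[OF D n x' l(2)]])
      (use segment_in_W[OF x'] eq in auto)
  ultimately have "D (Suc n) (x + 0 *\<^sub>R (c *\<^sub>R d)) ((c *\<^sub>R d) # l) = D (Suc n) (x + 0 *\<^sub>R (c *\<^sub>R d)) ((c *\<^sub>R d) # l')"
    by (rule vector_derivative_unique_within[rotated]) (simp add: at_within_Icc_at_right)
  thus ?thesis
    using c by (simp add: hders_scale[OF D n x l(1)] hders_scale[OF D n x l(2)])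
qed

lemma hders_truncate: "hders k \<phi> D \<Longrightarrow> k' \<le> k \<Longrightarrow> hders k' \<phi> D"
  by (auto simp: higher_derivs_def)

end

text \<open>\<open>B\<close> is a free parameter, later the norm of \<phi>, of an approximant or of
  a difference, so that every estimate below is linear in it.\<close>

locale Cr_family = normed_target Na W "TYPE('z::real_normed_vector)"
  for Na :: "'a::real_vector \<Rightarrow> real" and W :: "'a set" +
  fixes \<delta>1 r B :: real and \<phi> :: "'a \<Rightarrow> 'z::real_normed_vector" and D
  assumes \<delta>1: "0 < \<delta>1" "\<delta>1 \<le> 1" and r_pos: "0 < r" and B_nonneg: "0 \<le> B"
    and D: "hders (ord_k r) \<phi> D" and D_bound: "Cbound \<delta>1 r D B"
begin

lemma norm_D_le: "q \<le> ord_k r \<Longrightarrow> x \<in> W \<Longrightarrow> length hs = q \<Longrightarrow> norm (D q x hs) \<le> B * P hs"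
  by (rule CboundD(1)[OF D_bound])

section \<open>Mixed differences and Taylor remainders\<close>

text \<open>The top derivative is Hoelder by definition, and lower ones are Lipschitz because the
  next derivative is bounded. Lowering the exponent is free since the increment is at most
  \<open>\<delta>1 \<le> 1\<close>.\<close>

lemma D_hoelder:
  assumes j: "j \<le> ord_k r" "0 \<le> \<theta>" "\<theta> \<le> 1" "real j + \<theta> \<le> r"
    and xy: "x \<in> W" "y \<in> W" "Na (x - y) \<le> \<delta>1" and hs: "length hs = j"
  shows "norm (D j x hs - D j y hs) \<le> B * Na (x - y) powr \<theta> * P hs"
proof (cases "x = y")
  case False
  let ?a = "Na (x - y)"
  have a: "0 < ?a" "?a \<le> 1" using Na_diff_pos[OF False] xy \<delta>1 by auto
  have BP: "0 \<le> B * P hs" using B_nonneg P_nonneg by simp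
  show ?thesis
  proof (cases "j = ord_k r")
    case True
    have "norm (D j x hs - D j y hs) \<le> B * ?a powr ord_alpha r * P hs"
      using CboundD(2)[OF D_bound _ xy] hs r_pos True by simp
    also have "\<dots> = (B * P hs) * ?a powr ord_alpha r" by simp
    also have "\<dots> \<le> (B * P hs) * ?a powr \<theta>"
      using j(4) True ord_decomp[of r] a by (intro mult_left_mono[OF _ BP] powr_mono') auto
    finally show ?thesis by (simp add: mult_ac)
  next
    case False
    hence jk: "j < ord_k r" using j by simp
    let ?h = "x - y"
    have W: "y \<in> W" "y + ?h \<in> W" using xy by auto
    have "norm (D j (y + 1 *\<^sub>R ?h) hs - D j (y + 0 *\<^sub>R ?h) hs) \<le> B * P (?h # hs)"
      by (rule mvt_unit_interval[OF hders_directional[OF D jk W hs]])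
        (use jk hs segment_in_W[OF W] in \<open>auto intro!: norm_D_le simp del: prod_list.Cons list.map\<close>)
    also have "\<dots> = (B * P hs) * ?a powr 1" using a by simp
    also have "\<dots> \<le> (B * P hs) * ?a powr \<theta>"
      using j a by (intro mult_left_mono[OF _ BP] powr_mono') auto
    finally show ?thesis by (simp add: mult_ac)
  qed
qed simp

text \<open>If \<beta> + \<gamma> is at most 1, both differences along the shorter increment
  \<open>a\<close> are estimated separately, which gives the factor 2. Otherwise one derivative is
  spent along \<open>a\<close> and its difference along \<open>b\<close> is estimated.\<close>

lemma double_difference_le:
  assumes j: "j \<le> ord_k r" and \<beta>: "0 \<le> \<beta>" "\<beta> \<le> 1" and \<gamma>: "0 \<le> \<gamma>" "\<gamma> \<le> 1"
    and r: "real j + \<beta> + \<gamma> \<le> r"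
    and W: "p \<in> W" "p + a \<in> W" "p + b \<in> W" "p + a + b \<in> W"
    and ab: "Na a \<le> Na b" "Na b \<le> \<delta>1" and hs: "length hs = j"
  shows "norm (D j (p + a + b) hs - D j (p + b) hs - (D j (p + a) hs - D j p hs))
           \<le> 2 * B * Na a powr \<gamma> * Na b powr \<beta> * P hs"
proof (cases "a = 0")
  case False
  have a: "0 < Na a" using False Na_eq_0[of a] Na_nonneg[of a] by fastforce
  have b: "0 < Na b" using a ab by simp
  have BP: "0 \<le> B * P hs" using B_nonneg P_nonneg by simp
  show ?thesis
  proof (cases "\<beta> + \<gamma> \<le> 1")
    case True
    have "norm (D j (p + a + b) hs - D j (p + b) hs) \<le> B * Na ((p + a + b) - (p + b)) powr (\<beta> + \<gamma>) * P hs"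
      using True j \<beta> \<gamma> r W ab hs by (intro D_hoelder) auto
    moreover have "norm (D j (p + a) hs - D j p hs) \<le> B * Na ((p + a) - p) powr (\<beta> + \<gamma>) * P hs"
      using True j \<beta> \<gamma> r W ab hs by (intro D_hoelder) auto
    ultimately have "norm (D j (p + a + b) hs - D j (p + b) hs - (D j (p + a) hs - D j p hs))
       \<le> B * Na a powr (\<beta> + \<gamma>) * P hs + B * Na a powr (\<beta> + \<gamma>) * P hs"
      by - (rule order_trans[OF norm_triangle_ineq4 add_mono], simp_all)
    also have "\<dots> = 2 * (B * P hs) * (Na a powr \<gamma> * Na a powr \<beta>)" by (simp add: powr_add)
    \<comment> \<open>The shorter increment carries both exponents; its share \<beta> is handed over
      to the longer one.\<close>
    also have "\<dots> \<le> 2 * (B * P hs) * (Na a powr \<gamma> * Na b powr \<beta>)"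
      using BP \<beta> a ab by (intro mult_left_mono powr_mono2) auto
    finally show ?thesis by (simp add: mult_ac)
  next
    case False
    have "ord_alpha r \<le> 1" using ord_alpha_bounds[OF r_pos] by simp
    \<comment> \<open>As \<beta> + \<gamma> exceeds 1, and so the exponent of \<open>r\<close>, one
      more derivative exists. It yields the full power 1 of \<open>Na a\<close> and leaves \<theta>
      for \<open>b\<close>.\<close>
    hence jk: "j < ord_k r" using False r ord_decomp[of r] by linarith
    define \<theta> where "\<theta> = \<beta> + \<gamma> - 1"
    have W': "p + b \<in> W" "p + b + a \<in> W" using W by (simp_all add: algebra_simps)
    let ?f = "\<lambda>t. D j (p + b + t *\<^sub>R a) hs - D j (p + t *\<^sub>R a) hs"
    have "norm (?f 1 - ?f 0) \<le> B * Na b powr \<theta> * P (a # hs)"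
    proof (rule mvt_unit_interval)
      fix t :: real assume t: "t \<in> {0..1}"
      show "(?f has_vector_derivative
          (D (Suc j) (p + b + t *\<^sub>R a) (a # hs) - D (Suc j) (p + t *\<^sub>R a) (a # hs))) (at t within {0..1})"
        by (intro has_vector_derivative_diff hders_directional[OF D jk _ _ hs t] W W')
      have "norm (D (Suc j) (p + b + t *\<^sub>R a) (a # hs) - D (Suc j) (p + t *\<^sub>R a) (a # hs))
           \<le> B * Na ((p + b + t *\<^sub>R a) - (p + t *\<^sub>R a)) powr \<theta> * P (a # hs)"
        using False jk \<beta> \<gamma> r ab hs segment_in_W[OF W' t] segment_in_W[OF W(1,2) t]
        by (intro D_hoelder) (auto simp: \<theta>_def)
      thus "norm (D (Suc j) (p + b + t *\<^sub>R a) (a # hs) - D (Suc j) (p + t *\<^sub>R a) (a # hs))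
           \<le> B * Na b powr \<theta> * P (a # hs)" by simp
    qed
    \<comment> \<open>Only the power \<gamma> of \<open>Na a\<close> is kept; the surplus
      \<open>1 - \<gamma>\<close> passes to the larger \<open>Na b\<close> and completes \<theta> to
      \<beta>.\<close>
    also have "\<dots> = (B * P hs) * (Na a powr \<gamma> * Na a powr (1 - \<gamma>) * Na b powr \<theta>)"
      using a by (simp add: powr_add[symmetric])
    also have "\<dots> \<le> (B * P hs) * (Na a powr \<gamma> * Na b powr (1 - \<gamma>) * Na b powr \<theta>)"
      using BP \<gamma> a ab by (intro mult_left_mono mult_right_mono powr_mono2) auto
    also have "\<dots> = (B * P hs) * (Na a powr \<gamma> * Na b powr \<beta>)"
      by (simp add: mult.assoc powr_add[symmetric] \<theta>_def)
    also have "\<dots> \<le> 2 * (B * P hs) * (Na a powr \<gamma> * Na b powr \<beta>)"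
      using BP by (intro mult_right_mono) auto
    finally show ?thesis by (simp add: algebra_simps)
  qed
qed simp

text \<open>The double difference and its bound are invariant under exchanging
  \<open>(a, \<gamma>)\<close> with \<open>(b, \<beta>)\<close>, so the shorter increment may be
  taken first.\<close>

lemma double_difference:
  assumes j: "j \<le> ord_k r" and \<beta>: "0 \<le> \<beta>" "\<beta> \<le> 1" and \<gamma>: "0 \<le> \<gamma>" "\<gamma> \<le> 1"
    and r: "real j + \<beta> + \<gamma> \<le> r"
    and W: "p \<in> W" "p + a \<in> W" "p + b \<in> W" "p + a + b \<in> W"
    and ab: "Na a \<le> \<delta>1" "Na b \<le> \<delta>1" and hs: "length hs = j"
  shows "norm (D j (p + a + b) hs - D j (p + b) hs - (D j (p + a) hs - D j p hs))
           \<le> 2 * B * Na a powr \<gamma> * Na b powr \<beta> * P hs"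
proof (cases "Na a \<le> Na b")
  case True
  thus ?thesis using assms by (intro double_difference_le) auto
next
  case False
  have "p + b + a = p + a + b" by simp
  hence "norm (D j (p + b + a) hs - D j (p + a) hs - (D j (p + b) hs - D j p hs))
           \<le> 2 * B * Na b powr \<beta> * Na a powr \<gamma> * P hs"
    using False assms by (intro double_difference_le) (auto simp: algebra_simps)
  thus ?thesis by (simp add: algebra_simps)
qed

text \<open>After subtracting the linear term \<open>t *\<^sub>R ?v\<close>, the derivative along
  the segment is an increment of the next derivative, which is \<gamma>-Hoelder by
  \<open>D_hoelder\<close>.\<close>

lemma taylor_remainder:
  assumes j: "j < ord_k r" and \<gamma>: "0 \<le> \<gamma>" "\<gamma> \<le> 1" and r: "real j + 1 + \<gamma> \<le> r"
    and W: "p \<in> W" "p + h \<in> W" and h: "Na h \<le> \<delta>1" and hs: "length hs = j"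
  shows "norm (D j (p + h) hs - D j p hs - D (Suc j) p (h # hs)) \<le> B * Na h powr \<gamma> * Na h * P hs"
proof -
  let ?v = "D (Suc j) p (h # hs)"
  let ?f = "\<lambda>t. D j (p + t *\<^sub>R h) hs - t *\<^sub>R ?v"
  have "norm (?f 1 - ?f 0) \<le> B * Na h powr \<gamma> * P (h # hs)"
  proof (rule mvt_unit_interval)
    fix t :: real assume t: "t \<in> {0..1}"
    have "((\<lambda>t. t *\<^sub>R ?v) has_vector_derivative ?v) (at t within {0..1})"
      by (auto intro!: derivative_eq_intros)
    thus "(?f has_vector_derivative (D (Suc j) (p + t *\<^sub>R h) (h # hs) - ?v)) (at t within {0..1})"
      by (intro has_vector_derivative_diff hders_directional[OF D j _ _ hs t] W)
    have th: "Na (t *\<^sub>R h) \<le> Na h"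
      using t Na_nonneg[of h] by (simp add: Na_scale mult_left_le_one_le)
    have "norm (D (Suc j) (p + t *\<^sub>R h) (h # hs) - ?v) \<le> B * Na (p + t *\<^sub>R h - p) powr \<gamma> * P (h # hs)"
      using j \<gamma> r W hs h th segment_in_W[OF W t] by (intro D_hoelder) auto
    also have "\<dots> \<le> B * Na h powr \<gamma> * P (h # hs)"
      using B_nonneg P_nonneg[of "h # hs"] \<gamma> th Na_nonneg
      by (intro mult_right_mono mult_left_mono powr_mono2) auto
    finally show "norm (D (Suc j) (p + t *\<^sub>R h) (h # hs) - ?v) \<le> B * Na h powr \<gamma> * P (h # hs)" .
  qed
  thus ?thesis by (simp add: algebra_simps)
qed

text \<open>The same argument for the difference of two remainders: the derivative along
  \<open>a\<close> is now a double difference of order \<open>Suc j\<close> with increments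
  \<open>t a\<close> and \<open>b\<close>. This controls the \<beta>-Hoelder seminorm in x of the
  remainder in u.\<close>

lemma taylor_remainder_difference:
  assumes j: "j < ord_k r" and \<beta>: "0 \<le> \<beta>" "\<beta> \<le> 1" and \<gamma>: "0 \<le> \<gamma>" "\<gamma> \<le> 1"
    and r: "real j + 1 + \<beta> + \<gamma> \<le> r"
    and W: "p \<in> W" "p + a \<in> W" "p + b \<in> W" "p + a + b \<in> W"
    and ab: "Na a \<le> \<delta>1" "Na b \<le> \<delta>1" and hs: "length hs = j"
  shows "norm ((D j (p + a + b) hs - D j (p + b) hs - D (Suc j) (p + b) (a # hs))
               - (D j (p + a) hs - D j p hs - D (Suc j) p (a # hs)))
           \<le> 2 * B * Na a powr \<gamma> * Na b powr \<beta> * Na a * P hs"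
proof -
  let ?v = "D (Suc j) (p + b) (a # hs) - D (Suc j) p (a # hs)"
  let ?f = "\<lambda>t. D j (p + b + t *\<^sub>R a) hs - D j (p + t *\<^sub>R a) hs - t *\<^sub>R ?v"
  let ?f' = "\<lambda>t. D (Suc j) (p + b + t *\<^sub>R a) (a # hs) - D (Suc j) (p + t *\<^sub>R a) (a # hs) - ?v"
  have W': "p + b \<in> W" "p + b + a \<in> W" using W by (simp_all add: algebra_simps)
  have "norm (?f 1 - ?f 0) \<le> 2 * B * Na a powr \<gamma> * Na b powr \<beta> * P (a # hs)"
  proof (rule mvt_unit_interval)
    fix t :: real assume t: "t \<in> {0..1}"
    have "((\<lambda>t. t *\<^sub>R ?v) has_vector_derivative ?v) (at t within {0..1})"
      by (auto intro!: derivative_eq_intros)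
    thus "(?f has_vector_derivative ?f' t) (at t within {0..1})"
      by (intro has_vector_derivative_diff hders_directional[OF D j _ _ hs t] W W')
    have th: "Na (t *\<^sub>R a) \<le> Na a"
      using t Na_nonneg[of a] by (simp add: Na_scale mult_left_le_one_le)
    have *: "p + t *\<^sub>R a + b = p + b + t *\<^sub>R a" by simp
    have "norm (D (Suc j) (p + t *\<^sub>R a + b) (a # hs) - D (Suc j) (p + b) (a # hs)
          - (D (Suc j) (p + t *\<^sub>R a) (a # hs) - D (Suc j) p (a # hs)))
        \<le> 2 * B * Na (t *\<^sub>R a) powr \<gamma> * Na b powr \<beta> * P (a # hs)"
      using j \<beta> \<gamma> r W hs ab th segment_in_W[OF W(1,2) t] segment_in_W[OF W' t]
      by (intro double_difference) (auto simp: *)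
    also have "\<dots> \<le> 2 * B * Na a powr \<gamma> * Na b powr \<beta> * P (a # hs)"
      using B_nonneg P_nonneg[of "a # hs"] \<gamma> th Na_nonneg
      by (intro mult_right_mono mult_left_mono powr_mono2) auto
    finally show "norm (?f' t) \<le> 2 * B * Na a powr \<gamma> * Na b powr \<beta> * P (a # hs)"
      unfolding * by (simp add: algebra_simps)
  qed
  thus ?thesis by (simp add: algebra_simps)
qed

section \<open>Symmetry of the higher derivatives\<close>

text \<open>The double difference agrees with the second derivative up to an error of order 2 plus
  the Hoelder exponent in the size \<open>m\<close> of the increments, hence up to o(m^2).\<close>

lemma second_difference:
  assumes j: "Suc j < ord_k r" and hs: "length hs = j"
    and W: "p \<in> W" "p + b \<in> W" "p + a \<in> W" "p + b + a \<in> W"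
    and small: "Na a \<le> m" "Na b \<le> m" "2 * m \<le> \<delta>1"
  shows "norm (D j (p + b + a) hs - D j (p + b) hs - (D j (p + a) hs - D j p hs)
           - D (Suc (Suc j)) p (b # a # hs))
         \<le> 2 * (B * (2 * m) powr ord_alpha r * (2 * m) * m * P hs)"
proof -
  let ?\<theta> = "ord_alpha r"
  let ?v = "D (Suc (Suc j)) p (b # a # hs)"
  let ?f = "\<lambda>t. D j (p + b + t *\<^sub>R a) hs - D j (p + t *\<^sub>R a) hs - t *\<^sub>R ?v"
  let ?f' = "\<lambda>t. D (Suc j) (p + b + t *\<^sub>R a) (a # hs) - D (Suc j) (p + t *\<^sub>R a) (a # hs) - ?v"
  have j': "j < ord_k r" using j by simp
  have \<theta>: "0 < ?\<theta>" "?\<theta> \<le> 1" using ord_alpha_bounds[OF r_pos] by auto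
  have \<theta>r: "real (Suc j) + 1 + ?\<theta> \<le> r" using j ord_decomp[of r] by linarith
  have m: "0 \<le> m" using small(1) Na_nonneg[of a] by linarith
  have l: "length (a # hs) = Suc j" using hs by simp
  have remainder: "norm (D (Suc j) (p + h) (a # hs) - D (Suc j) p (a # hs) - D (Suc (Suc j)) p (h # a # hs))
      \<le> B * (2 * m) powr ?\<theta> * (2 * m) * m * P hs"
    if h: "p + h \<in> W" "Na h \<le> 2 * m" for h
  proof -
    have "norm (D (Suc j) (p + h) (a # hs) - D (Suc j) p (a # hs) - D (Suc (Suc j)) p (h # a # hs))
       \<le> B * Na h powr ?\<theta> * Na h * P (a # hs)"
      using h small by (intro taylor_remainder[OF j _ \<theta>(2) \<theta>r W(1) _ _ l]) (use \<theta> in auto)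
    also have "\<dots> \<le> B * (2 * m) powr ?\<theta> * (2 * m) * (m * P hs)"
      using h small \<theta> m B_nonneg Na_nonneg P_nonneg
      by (auto intro!: mult_mono powr_mono2)
    finally show ?thesis by (simp add: mult_ac)
  qed
  have "norm (?f 1 - ?f 0) \<le> 2 * (B * (2 * m) powr ?\<theta> * (2 * m) * m * P hs)"
  proof (rule mvt_unit_interval)
    fix t :: real assume t: "t \<in> {0..1}"
    have "((\<lambda>t. t *\<^sub>R ?v) has_vector_derivative ?v) (at t within {0..1})"
      by (auto intro!: derivative_eq_intros)
    thus "(?f has_vector_derivative ?f' t) (at t within {0..1})"
      by (intro has_vector_derivative_diff hders_directional[OF D j' _ _ hs t] W)
    have th: "Na (t *\<^sub>R a) \<le> m"
      using t Na_nonneg[of a] small mult_left_le_one_le[of "Na a" t] by (simp add: Na_scale)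
    have t1: "p + t *\<^sub>R a \<in> W" "p + (b + t *\<^sub>R a) \<in> W"
      using segment_in_W[OF W(1,3) t] segment_in_W[OF W(2,4) t] by (simp_all add: add.assoc)
    have "Na (b + t *\<^sub>R a) \<le> 2 * m" using Na_add[of b "t *\<^sub>R a"] th small by linarith
    note r1 = remainder[OF t1(2) this]
    have "Na (t *\<^sub>R a) \<le> 2 * m" using th m by linarith
    note r2 = remainder[OF t1(1) this]
    \<comment> \<open>Additivity in the first slot writes \<open>?f' t\<close> as the difference of
      two Taylor remainders based at \<open>p\<close>, with increments \<open>b + t a\<close> and
      \<open>t a\<close>, both of size at most \<open>2 * m\<close>.\<close>
    have ml: "D (Suc (Suc j)) p ((b + t *\<^sub>R a) # a # hs) = ?v + D (Suc (Suc j)) p ((t *\<^sub>R a) # a # hs)"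
      by (rule hders_ml_add[OF D j W(1) l])
    have "?f' t = (D (Suc j) (p + (b + t *\<^sub>R a)) (a # hs) - D (Suc j) p (a # hs)
              - D (Suc (Suc j)) p ((b + t *\<^sub>R a) # a # hs))
          - (D (Suc j) (p + t *\<^sub>R a) (a # hs) - D (Suc j) p (a # hs) - D (Suc (Suc j)) p ((t *\<^sub>R a) # a # hs))"
      unfolding ml by (simp add: algebra_simps)
    also have "norm \<dots> \<le> 2 * (B * (2 * m) powr ?\<theta> * (2 * m) * m * P hs)"
      unfolding mult_2[of "_ * P hs"] by (rule order_trans[OF norm_triangle_ineq4 add_mono[OF r1 r2]])
    finally show "norm (?f' t) \<le> 2 * (B * (2 * m) powr ?\<theta> * (2 * m) * m * P hs)" .
  qed
  thus ?thesis by (simp add: algebra_simps)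
qed

text \<open>The double difference is symmetric in its increments. Both orders of the second
  derivative approximate it at scale \<open>c\<close> with an error smaller than
  \<open>c * c\<close>; divide and let \<open>c\<close> tend to 0.\<close>

lemma symmetric_second:
  assumes j: "Suc j < ord_k r" and hs: "length hs = j" and p: "p \<in> W"
  shows "D (Suc (Suc j)) p (b # a # hs) = D (Suc (Suc j)) p (a # b # hs)"
proof -
  let ?\<theta> = "ord_alpha r"
  let ?X = "\<lambda>a b. D (Suc (Suc j)) p (b # a # hs)"
  have \<theta>: "0 < ?\<theta>" using ord_alpha_bounds[OF r_pos] by auto
  define M where "M = Na a + Na b + 1"
  have M: "0 < M" "Na a \<le> M" "Na b \<le> M" using Na_nonneg[of a] Na_nonneg[of b] by (auto simp: M_def)
  obtain \<delta> where \<delta>: "0 < \<delta>" "\<And>h. Na h < \<delta> \<Longrightarrow> p + h \<in> W" using W_open[OF p] by blast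
  \<comment> \<open>For \<open>c < e\<close> the scaled increments have size at most
    \<open>m = c * M\<close>, with \<open>4 * m\<close> below \<delta> and \<open>\<delta>1\<close>:
    all corners lie in \<open>W\<close> and \<open>second_difference\<close> applies.\<close>
  define e where "e = min \<delta> \<delta>1 / (4 * M)"
  have e: "0 < e" using \<delta> \<delta>1 M by (simp add: e_def)
  \<comment> \<open>The 8 collects the two errors, the factor 2 in each, and the 2 in
    \<open>2 * m\<close>.\<close>
  define K where "K = 8 * B * M * M * P hs"
  have main: "norm (?X a b - ?X b a) \<le> K * (2 * M * c) powr ?\<theta>" if c: "0 < c" "c < e" for c
  proof -
    define m where "m = c * M"
    have "4 * m < min \<delta> \<delta>1"
      using c(2) M unfolding m_def e_def by (simp add: less_divide_eq mult_ac)
    hence m4: "4 * m < \<delta>" "4 * m < \<delta>1" by auto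
    have m: "0 < m" using c M by (simp add: m_def)
    let ?a = "c *\<^sub>R a" and ?b = "c *\<^sub>R b"
    have Na: "Na ?a \<le> m" "Na ?b \<le> m" using c M by (auto simp: Na_scale m_def)
    have Nab: "Na (?a + ?b) \<le> 2 * m" "Na (?b + ?a) \<le> 2 * m"
      using Na_add[of ?a ?b] Na_add[of ?b ?a] Na by linarith+
    have W: "p + ?a \<in> W" "p + ?b \<in> W" "p + ?b + ?a \<in> W" "p + ?a + ?b \<in> W"
      using \<delta>(2)[of ?a] \<delta>(2)[of ?b] \<delta>(2)[of "?b + ?a"] \<delta>(2)[of "?a + ?b"] Na Nab m4 m
      by (simp_all add: add.assoc)
    let ?R = "2 * (B * (2 * m) powr ?\<theta> * (2 * m) * m * P hs)"
    let ?\<Delta> = "D j (p + ?b + ?a) hs - D j (p + ?b) hs - (D j (p + ?a) hs - D j p hs)"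
    have sc: "?X ?a ?b = (c * c) *\<^sub>R ?X a b" "?X ?b ?a = (c * c) *\<^sub>R ?X b a"
      using hs by (simp_all add: hders_scale[OF D j p] hders_ml_scale2[OF D j p hs])
    have eq: "p + ?a + ?b = p + ?b + ?a" by simp
    have 1: "norm (?\<Delta> - ?X ?a ?b) \<le> ?R"
      using m4 m by (intro second_difference[OF j hs p W(2,1,3) Na]) auto
    have "norm (D j (p + ?a + ?b) hs - D j (p + ?a) hs - (D j (p + ?b) hs - D j p hs) - ?X ?b ?a) \<le> ?R"
      using m4 m by (intro second_difference[OF j hs p W(1,2,4) Na(2,1)]) auto
    hence 2: "norm (?\<Delta> - ?X ?b ?a) \<le> ?R"
      unfolding eq by (simp add: algebra_simps)
    have "(c * c) * norm (?X a b - ?X b a) = norm ((c * c) *\<^sub>R ?X a b - (c * c) *\<^sub>R ?X b a)"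
      by (simp add: scaleR_diff_right[symmetric])
    also have "\<dots> = norm ((?\<Delta> - ?X ?b ?a) - (?\<Delta> - ?X ?a ?b))" by (simp add: sc)
    also have "\<dots> \<le> ?R + ?R" by (rule order_trans[OF norm_triangle_ineq4 add_mono[OF 2 1]])
    also have "\<dots> = (c * c) * (K * (2 * M * c) powr ?\<theta>)"
      by (simp add: K_def m_def mult_ac)
    finally show ?thesis using c by simp
  qed
  have "((\<lambda>c. K * (2 * M * c) powr ?\<theta>) \<longlongrightarrow> K * (2 * M * 0) powr ?\<theta>) (at_right 0)"
    using \<theta> M by (intro tendsto_intros tendsto_powr') (auto intro!: eventually_at_rightI[of 0 1])
  moreover have "eventually (\<lambda>c. norm (?X a b - ?X b a) \<le> K * (2 * M * c) powr ?\<theta>) (at_right 0)"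
    using e main by (intro eventually_at_rightI[of 0 e]) auto
  ultimately have "norm (?X a b - ?X b a) \<le> K * (2 * M * 0) powr ?\<theta>"
    by (intro tendsto_lowerbound) auto
  thus ?thesis by simp
qed

text \<open>Symmetry in the form needed for slices: one vector moves past a block. The induction
  swaps it with the head of the block, then differentiates the identity of one order less along that
  head.\<close>

lemma symmetric_front:
  assumes "length ks + length hs < ord_k r" "x \<in> W"
  shows "D (Suc (length ks + length hs)) x (c # ks @ hs) = D (Suc (length ks + length hs)) x (ks @ c # hs)"
  using assms
proof (induction ks arbitrary: x)
  case (Cons d ks)
  let ?n = "length ks + length hs"
  have "D (Suc (Suc ?n)) x (c # d # ks @ hs) = D (Suc (Suc ?n)) x (d # c # ks @ hs)"
    using Cons.prems by (intro symmetric_second) auto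
  also have "\<dots> = D (Suc (Suc ?n)) x (d # ks @ c # hs)"
    using Cons.prems Cons.IH by (intro hders_front_cong[OF D]) auto
  finally show ?case by simp
qed simp

end

subsection \<open>Linear structure and embeddings\<close>

lemma multilinear_on_lincomb:
  assumes "multilinear_on q L" "multilinear_on q M"
  shows "multilinear_on q (\<lambda>hs. a *\<^sub>R L hs + b *\<^sub>R M hs)"
  using assms unfolding multilinear_on_def
  by (auto simp: scaleR_add_right mult.commute)

lemma bounded_ml_UNIV_iff:
  "bounded_ml Na UNIV Ny q L \<longleftrightarrow> multilinear_on q L \<and> ml_bounds Na Ny q L \<noteq> {}"
  by (simp add: bounded_ml_def)

context normed_target
begin

lemma hders_lincomb:
  assumes D: "hders k f D" and E: "hders k g E"
  shows "hders k (\<lambda>x. a *\<^sub>R f x + b *\<^sub>R g x) (\<lambda>q x hs. a *\<^sub>R D q x hs + b *\<^sub>R E q x hs)"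
  unfolding higher_derivs_iff
proof (intro conjI allI ballI impI)
  show "a *\<^sub>R D 0 x [] + b *\<^sub>R E 0 x [] = a *\<^sub>R f x + b *\<^sub>R g x" if "x \<in> W" for x
    using hders_0[OF D that] hders_0[OF E that] by simp
next
  fix q x assume *: "q \<le> k" "x \<in> W"
  obtain A where A: "A \<in> ml_bounds Na norm q (D q x)" using hders_bounds[OF D *] by blast
  obtain B where B: "B \<in> ml_bounds Na norm q (E q x)" using hders_bounds[OF E *] by blast
  have "norm (a *\<^sub>R D q x hs + b *\<^sub>R E q x hs) \<le> (\<bar>a\<bar> * A + \<bar>b\<bar> * B) * P hs" if "length hs = q" for hs
  proof -
    have "norm (a *\<^sub>R D q x hs + b *\<^sub>R E q x hs) \<le> \<bar>a\<bar> * norm (D q x hs) + \<bar>b\<bar> * norm (E q x hs)"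
      by (rule order_trans[OF norm_triangle_ineq]) simp
    also have "\<dots> \<le> \<bar>a\<bar> * (A * P hs) + \<bar>b\<bar> * (B * P hs)"
      using A B that by (intro add_mono mult_left_mono) (auto simp: ml_bounds_def)
    finally show ?thesis by (simp add: algebra_simps)
  qed
  hence "\<bar>a\<bar> * A + \<bar>b\<bar> * B \<in> ml_bounds Na norm q (\<lambda>hs. a *\<^sub>R D q x hs + b *\<^sub>R E q x hs)"
    using A B by (auto simp: ml_bounds_def)
  moreover have "multilinear_on q (\<lambda>hs. a *\<^sub>R D q x hs + b *\<^sub>R E q x hs)"
    using hders_ml[OF D *] hders_ml[OF E *] by (intro multilinear_on_lincomb) (auto simp: bounded_ml_def)
  ultimately show "bounded_ml Na UNIV norm q (\<lambda>hs. a *\<^sub>R D q x hs + b *\<^sub>R E q x hs)"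
    by (auto simp: bounded_ml_UNIV_iff)
next
  fix q x and \<epsilon> :: real assume *: "q < k" "x \<in> W" "0 < \<epsilon>"
  define e where "e = \<epsilon> / (\<bar>a\<bar> + \<bar>b\<bar> + 1)"
  have e: "0 < e" using * by (simp add: e_def add_nonneg_pos)
  have e': "(\<bar>a\<bar> + \<bar>b\<bar>) * e \<le> \<epsilon>" using * by (simp add: e_def field_simps)
  obtain d1 where d1: "0 < d1" "\<And>h hs. Na h < d1 \<Longrightarrow> x + h \<in> W \<Longrightarrow> length hs = q \<Longrightarrow>
      norm (D q (x + h) hs - D q x hs - D (Suc q) x (h # hs)) \<le> e * Na h * P hs"
    using hders_deriv[OF D *(1,2) e] by blast
  obtain d2 where d2: "0 < d2" "\<And>h hs. Na h < d2 \<Longrightarrow> x + h \<in> W \<Longrightarrow> length hs = q \<Longrightarrow>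
      norm (E q (x + h) hs - E q x hs - E (Suc q) x (h # hs)) \<le> e * Na h * P hs"
    using hders_deriv[OF E *(1,2) e] by blast
  show "\<exists>\<delta>>0. \<forall>h. Na h < \<delta> \<and> x + h \<in> W \<longrightarrow> (\<forall>hs. length hs = q \<longrightarrow>
      norm (a *\<^sub>R D q (x + h) hs + b *\<^sub>R E q (x + h) hs - (a *\<^sub>R D q x hs + b *\<^sub>R E q x hs)
         - (a *\<^sub>R D (Suc q) x (h # hs) + b *\<^sub>R E (Suc q) x (h # hs))) \<le> \<epsilon> * Na h * P hs)"
  proof (intro exI[of _ "min d1 d2"] conjI allI impI)
    show "0 < min d1 d2" using d1 d2 by simp
    fix h and hs :: "'a list" assume h: "Na h < min d1 d2 \<and> x + h \<in> W" and hs: "length hs = q"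
    let ?u = "D q (x + h) hs - D q x hs - D (Suc q) x (h # hs)"
    let ?v = "E q (x + h) hs - E q x hs - E (Suc q) x (h # hs)"
    have "a *\<^sub>R D q (x + h) hs + b *\<^sub>R E q (x + h) hs - (a *\<^sub>R D q x hs + b *\<^sub>R E q x hs)
         - (a *\<^sub>R D (Suc q) x (h # hs) + b *\<^sub>R E (Suc q) x (h # hs)) = a *\<^sub>R ?u + b *\<^sub>R ?v"
      by (simp add: algebra_simps)
    also have "norm \<dots> \<le> \<bar>a\<bar> * norm ?u + \<bar>b\<bar> * norm ?v"
      by (rule order_trans[OF norm_triangle_ineq]) simp
    also have "\<dots> \<le> \<bar>a\<bar> * (e * Na h * P hs) + \<bar>b\<bar> * (e * Na h * P hs)"
      using h hs by (intro add_mono mult_left_mono d1 d2) auto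
    also have "\<dots> = ((\<bar>a\<bar> + \<bar>b\<bar>) * e) * (Na h * P hs)" by (simp add: algebra_simps)
    also have "\<dots> \<le> \<epsilon> * (Na h * P hs)"
      using e' by (intro mult_right_mono) (auto simp: Na_nonneg P_nonneg)
    finally show "norm (a *\<^sub>R D q (x + h) hs + b *\<^sub>R E q (x + h) hs - (a *\<^sub>R D q x hs + b *\<^sub>R E q x hs)
         - (a *\<^sub>R D (Suc q) x (h # hs) + b *\<^sub>R E (Suc q) x (h # hs))) \<le> \<epsilon> * Na h * P hs"
      by (simp add: mult.assoc)
  qed
qed

lemma hders_diff:
  assumes "hders k f D" "hders k g E"
  shows "hders k (\<lambda>x. f x - g x) (\<lambda>q x hs. D q x hs - E q x hs)"
  using hders_lincomb[OF assms, of 1 "-1"] by simp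

lemma Cbound_lincomb:
  assumes "Cbound \<delta>1 r D A" "Cbound \<delta>1 r E B"
  shows "Cbound \<delta>1 r (\<lambda>q x hs. a *\<^sub>R D q x hs + b *\<^sub>R E q x hs) (\<bar>a\<bar> * A + \<bar>b\<bar> * B)"
  unfolding Cbound_def
proof (intro conjI allI ballI impI)
  fix q x and hs :: "'a list" assume *: "q \<le> ord_k r" "x \<in> W" "length hs = q"
  have "norm (a *\<^sub>R D q x hs + b *\<^sub>R E q x hs) \<le> \<bar>a\<bar> * norm (D q x hs) + \<bar>b\<bar> * norm (E q x hs)"
    by (rule order_trans[OF norm_triangle_ineq]) simp
  also have "\<dots> \<le> \<bar>a\<bar> * (A * P hs) + \<bar>b\<bar> * (B * P hs)"
    by (intro add_mono mult_left_mono CboundD(1)[OF assms(1) *] CboundD(1)[OF assms(2) *]) auto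
  finally show "norm (a *\<^sub>R D q x hs + b *\<^sub>R E q x hs) \<le> (\<bar>a\<bar> * A + \<bar>b\<bar> * B) * P hs"
    by (simp add: algebra_simps)
next
  fix x y and hs :: "'a list"
  let ?k = "ord_k r"
  let ?p = "Na (x - y) powr ord_alpha r"
  assume *: "r \<noteq> 0" "x \<in> W" "y \<in> W" "Na (x - y) \<le> \<delta>1" "length hs = ?k"
  have "a *\<^sub>R D ?k x hs + b *\<^sub>R E ?k x hs - (a *\<^sub>R D ?k y hs + b *\<^sub>R E ?k y hs)
     = a *\<^sub>R (D ?k x hs - D ?k y hs) + b *\<^sub>R (E ?k x hs - E ?k y hs)" by (simp add: algebra_simps)
  also have "norm \<dots> \<le> \<bar>a\<bar> * norm (D ?k x hs - D ?k y hs) + \<bar>b\<bar> * norm (E ?k x hs - E ?k y hs)"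
    by (rule order_trans[OF norm_triangle_ineq]) simp
  also have "\<dots> \<le> \<bar>a\<bar> * (A * ?p * P hs) + \<bar>b\<bar> * (B * ?p * P hs)"
    by (intro add_mono mult_left_mono CboundD(2)[OF assms(1) *] CboundD(2)[OF assms(2) *]) auto
  finally show "norm (a *\<^sub>R D ?k x hs + b *\<^sub>R E ?k x hs - (a *\<^sub>R D ?k y hs + b *\<^sub>R E ?k y hs))
     \<le> (\<bar>a\<bar> * A + \<bar>b\<bar> * B) * ?p * P hs" by (simp add: algebra_simps)
qed

abbreviation "cont f \<equiv> \<forall>x\<in>W. \<forall>\<epsilon>>0. \<exists>\<delta>>0. \<forall>y\<in>W. Na (y - x) < \<delta> \<longrightarrow> norm (f y - f x) < \<epsilon>"

text \<open>Unlike \<open>CrI\<close> this covers \<open>r = 0\<close>, where continuity is demanded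
  besides the bound.\<close>

lemma CrI':
  assumes D: "hders (ord_k r) f D" and B: "Cbound \<delta>1 r D B" "0 \<le> B" and c: "r = 0 \<Longrightarrow> cont f"
  shows "f \<in> Cr \<delta>1 Na UNIV norm W r"
proof (cases "r = 0")
  case True
  have "norm (f x) \<le> B" if "x \<in> W" for x
    using CboundD(1)[OF B(1), of 0 x "[]"] hders_0[OF D that] that by simp
  hence "bdd_above ((\<lambda>x. norm (f x)) ` W)" by (auto intro!: bdd_aboveI)
  thus ?thesis using True c by (simp add: Cr_def)
qed (use CrI assms in blast)

lemma Cr_lincomb:
  fixes f g :: "'a \<Rightarrow> 'z"
  assumes f: "f \<in> Cr \<delta>1 Na UNIV norm W r" and g: "g \<in> Cr \<delta>1 Na UNIV norm W r"
  shows "(\<lambda>x. a *\<^sub>R f x + b *\<^sub>R g x) \<in> Cr \<delta>1 Na UNIV norm W r" (is ?A)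
    and "Cr_norm \<delta>1 Na UNIV norm W r (\<lambda>x. a *\<^sub>R f x + b *\<^sub>R g x)
      \<le> \<bar>a\<bar> * Cr_norm \<delta>1 Na UNIV norm W r f + \<bar>b\<bar> * Cr_norm \<delta>1 Na UNIV norm W r g" (is ?B)
proof -
  obtain D where D: "hders (ord_k r) f D" using Cr_hders_ex[OF f] .
  obtain E where E: "hders (ord_k r) g E" using Cr_hders_ex[OF g] .
  note h = hders_lincomb[OF D E, of a b]
  note B = Cbound_lincomb[OF Cbound_Cr_norm[OF f D] Cbound_Cr_norm[OF g E], of a b]
  have nn: "0 \<le> \<bar>a\<bar> * Cr_norm \<delta>1 Na UNIV norm W r f + \<bar>b\<bar> * Cr_norm \<delta>1 Na UNIV norm W r g"
    using Cr_norm_nonneg[OF f] Cr_norm_nonneg[OF g] by simp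
  have "cont (\<lambda>x. a *\<^sub>R f x + b *\<^sub>R g x)" if "r = 0"
  proof (intro ballI allI impI)
    fix x and \<epsilon> :: real assume *: "x \<in> W" "0 < \<epsilon>"
    define e where "e = \<epsilon> / (\<bar>a\<bar> + \<bar>b\<bar> + 1)"
    have e: "0 < e" using * by (simp add: e_def add_nonneg_pos)
    have e': "(\<bar>a\<bar> + \<bar>b\<bar>) * e < \<epsilon>" using * by (simp add: e_def field_simps)
    have cf: "cont f" "cont g" using f g that by (auto simp: Cr_def)
    obtain d1 where d1: "0 < d1" "\<And>y. y \<in> W \<Longrightarrow> Na (y - x) < d1 \<Longrightarrow> norm (f y - f x) < e"
      using cf(1) * e by meson
    obtain d2 where d2: "0 < d2" "\<And>y. y \<in> W \<Longrightarrow> Na (y - x) < d2 \<Longrightarrow> norm (g y - g x) < e"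
      using cf(2) * e by meson
    show "\<exists>\<delta>>0. \<forall>y\<in>W. Na (y - x) < \<delta> \<longrightarrow> norm (a *\<^sub>R f y + b *\<^sub>R g y - (a *\<^sub>R f x + b *\<^sub>R g x)) < \<epsilon>"
    proof (intro exI[of _ "min d1 d2"] conjI ballI impI)
      show "0 < min d1 d2" using d1 d2 by simp
      fix y assume y: "y \<in> W" "Na (y - x) < min d1 d2"
      have "a *\<^sub>R f y + b *\<^sub>R g y - (a *\<^sub>R f x + b *\<^sub>R g x) = a *\<^sub>R (f y - f x) + b *\<^sub>R (g y - g x)"
        by (simp add: algebra_simps)
      also have "norm \<dots> \<le> \<bar>a\<bar> * norm (f y - f x) + \<bar>b\<bar> * norm (g y - g x)"
        by (rule order_trans[OF norm_triangle_ineq]) simp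
      also have "\<dots> \<le> \<bar>a\<bar> * e + \<bar>b\<bar> * e"
        using y by (intro add_mono mult_left_mono less_imp_le[OF d1(2)] less_imp_le[OF d2(2)]) auto
      also have "\<dots> < \<epsilon>" using e' by (simp add: algebra_simps)
      finally show "norm (a *\<^sub>R f y + b *\<^sub>R g y - (a *\<^sub>R f x + b *\<^sub>R g x)) < \<epsilon>" .
    qed
  qed
  thus ?A by (rule CrI'[OF h B nn])
  show ?B by (rule Cr_norm_le[OF h B nn])
qed

lemma Cr_zero: "(\<lambda>x. 0 :: 'z) \<in> Cr \<delta>1 Na UNIV norm W r"
proof (rule CrI'[where B = 0 and D = "\<lambda>_ _ _. 0"])
  show "hders (ord_k r) (\<lambda>x. 0 :: 'z) (\<lambda>_ _ _. 0)"
    unfolding higher_derivs_iff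
    by (auto simp: bounded_ml_def multilinear_on_def ml_bounds_def Na_nonneg P_nonneg
        intro: exI[of _ 0] exI[of _ 1])
qed (auto simp: Cbound_def P_nonneg intro: exI[of _ 1])

text \<open>These are the axioms that let C^s(V;Z) be the target of
  \<open>hoelder_space\<close>.\<close>

lemma Cr_space: 
  fixes \<delta> r
  defines "S \<equiv> Cr \<delta> Na (UNIV :: 'z set) norm W r" and "N \<equiv> Cr_norm \<delta> Na (UNIV :: 'z set) norm W r"
  shows "subspace S"
    and "f \<in> S \<Longrightarrow> N (c *\<^sub>R f) = \<bar>c\<bar> * N f"
    and "f \<in> S \<Longrightarrow> g \<in> S \<Longrightarrow> N (f + g) \<le> N f + N g"
proof -
  have lin: "a *\<^sub>R f + b *\<^sub>R g \<in> S" "N (a *\<^sub>R f + b *\<^sub>R g) \<le> \<bar>a\<bar> * N f + \<bar>b\<bar> * N g"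
    if "f \<in> S" "g \<in> S" for f g a b
    using Cr_lincomb[of f \<delta> r g a b] that by (simp_all add: S_def N_def plus_fun_def scaleR_fun_def)
  have zero: "0 \<in> S" using Cr_zero[of \<delta> r] by (simp add: S_def zero_fun_def)
  show "subspace S"
    unfolding subspace_def using zero lin(1)[of _ _ 1 1] lin(1)[OF _ zero] by auto
  show "N (f + g) \<le> N f + N g" if "f \<in> S" "g \<in> S" using lin(2)[OF that, of 1 1] by simp
  have le: "N (c *\<^sub>R f) \<le> \<bar>c\<bar> * N f" if "f \<in> S" for c f
    using lin(2)[OF that that, of c 0] by simp
  show "N (c *\<^sub>R f) = \<bar>c\<bar> * N f" if f: "f \<in> S"
  proof (cases "c = 0")
    case True
    have "0 \<le> N (c *\<^sub>R f)"
      using lin(1)[OF f f, of c 0] unfolding S_def N_def by (intro Cr_norm_nonneg) simp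
    thus ?thesis using le[OF f, of c] True by simp
  next
    case False
    have "N f \<le> \<bar>inverse c\<bar> * N (c *\<^sub>R f)"
      using le[of "c *\<^sub>R f" "inverse c"] lin(1)[OF f f, of c 0] False by simp
    hence "\<bar>c\<bar> * N f \<le> N (c *\<^sub>R f)" using False by (simp add: field_simps)
    thus ?thesis using le[OF f, of c] by simp
  qed
qed

text \<open>Bounded multilinear maps into \<open>C^s(V;Z)\<close> have to be multilinear as total functions of \<open>x\<close>, so
  the derivatives must be multilinear off the domain as well.\<close>

lemma hders_normalize:
  assumes D: "hders k f D"
  obtains E where "hders k f E" "\<And>p. E 0 p [] = f p" "\<And>q p. q \<le> k \<Longrightarrow> multilinear_on q (E q p)"
proof -
  \<comment> \<open>Off \<open>W\<close> the order 0 keeps the values of \<open>f\<close>, so that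
    the two maps agree as total functions, and all higher orders are 0, which is
    multilinear.\<close>
  let ?E = "\<lambda>q p hs. if p \<in> W then D q p hs else if q = 0 then f p else 0"
  have 0: "?E 0 p [] = f p" for p using hders_0[OF D] by simp
  have ml: "multilinear_on q (?E q p)" if "q \<le> k" for q p
  proof (cases "p \<in> W")
    case True thus ?thesis using hders_ml[OF D that True] by (simp add: bounded_ml_def)
  next
    case False thus ?thesis by (auto simp: multilinear_on_def)
  qed
  have "?E q p = D q p" if "p \<in> W" for q p using that by simp
  hence "hders k f ?E"
    using D unfolding higher_derivs_def by (simp cong: conj_cong)
  thus ?thesis using 0 ml by (rule that)
qed

end

text \<open>The same derivatives, truncated, with the same \<open>B\<close>:
  \<open>D_hoelder\<close> supplies the Hoelder condition of the smaller order. It places the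
  approximants from C^r' in C^r.\<close>

lemma (in Cr_family) Cr_embed:
  assumes "0 < r'" "r' \<le> r"
  shows "\<phi> \<in> Cr \<delta>1 Na UNIV norm W r'"
proof (rule CrI)
  have k: "ord_k r' \<le> ord_k r" by (rule ord_k_mono) fact
  show "r' \<noteq> 0" using assms by simp
  show "hders (ord_k r') \<phi> D" by (rule hders_truncate[OF D k])
  show "Cbound \<delta>1 r' D B"
    unfolding Cbound_def
    using k ord_alpha_bounds[OF assms(1)] assms(2) ord_decomp[of r']
    by (auto intro!: norm_D_le D_hoelder)
qed (rule B_nonneg)

subsection \<open>Slices of maps on a product\<close>

lemma small_powr:
  fixes K \<gamma> \<epsilon> d :: real
  assumes "0 \<le> K" "0 < \<gamma>" "0 < \<epsilon>" "0 < d"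
  obtains \<delta> where "0 < \<delta>" "\<delta> \<le> d" "\<And>a. 0 \<le> a \<Longrightarrow> a < \<delta> \<Longrightarrow> K * a powr \<gamma> < \<epsilon>"
proof
  \<comment> \<open>The second entry solves
    \<open>(K + 1) * \<delta> powr \<gamma> = \<epsilon>\<close>; adding 1 covers
    \<open>K = 0\<close>.\<close>
  define \<delta> where "\<delta> = min d ((\<epsilon> / (K + 1)) powr (1 / \<gamma>))"
  show "0 < \<delta>" "\<delta> \<le> d" using assms by (auto simp: \<delta>_def)
  fix a :: real assume a: "0 \<le> a" "a < \<delta>"
  have "a powr \<gamma> < ((\<epsilon> / (K + 1)) powr (1 / \<gamma>)) powr \<gamma>"
    using a assms by (intro powr_less_mono2) (auto simp: \<delta>_def)
  also have "\<dots> = \<epsilon> / (K + 1)" using assms by (simp add: powr_powr)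
  finally have *: "a powr \<gamma> * (K + 1) < \<epsilon>" using assms by (simp add: pos_less_divide_eq)
  have "K * a powr \<gamma> \<le> a powr \<gamma> * (K + 1)" by (simp add: algebra_simps)
  thus "K * a powr \<gamma> < \<epsilon>" using * by linarith
qed

definition slice ::
  "(nat \<Rightarrow> 'u::real_normed_vector \<times> 'v::real_normed_vector \<Rightarrow> ('u \<times> 'v) list \<Rightarrow> 'z) \<Rightarrow>
     nat \<Rightarrow> 'u \<Rightarrow> 'u list \<Rightarrow> 'v \<Rightarrow> 'z"
  where "slice D q u hs = (\<lambda>x. D q (u, x) (map (\<lambda>h. (h, 0)) hs))"

text \<open>The p-th derivative of the slice in x. The V-directions stand in front of the
  U-directions because \<open>higher_derivs\<close> puts the newest direction at the head of the
  list.\<close>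

definition slice_deriv ::
  "(nat \<Rightarrow> 'u::real_normed_vector \<times> 'v::real_normed_vector \<Rightarrow> ('u \<times> 'v) list \<Rightarrow> 'z) \<Rightarrow>
     nat \<Rightarrow> 'u \<Rightarrow> 'u list \<Rightarrow> nat \<Rightarrow> 'v \<Rightarrow> 'v list \<Rightarrow> 'z"
  where "slice_deriv D q u hs = (\<lambda>p x ks. D (p + q) (u, x) (map (Pair 0) ks @ map (\<lambda>h. (h, 0)) hs))"

lemma max_norm_Pair [simp]:
  "max_norm (h, 0) = norm h" "max_norm (0, h') = norm h'"
  by (simp_all add: max_norm_def)

lemma prod_list_max_norm [simp]:
  "prod_list (map max_norm (map (\<lambda>h. (h, 0)) hs)) = prod_list (map norm hs)"
  "prod_list (map max_norm (map (Pair 0) ks)) = prod_list (map norm ks)"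
  by (simp_all add: comp_def)

lemma multilinear_onD:
  assumes "multilinear_on q L" "length hs1 + length hs2 + 1 = q"
  shows "L (hs1 @ (a + b) # hs2) = L (hs1 @ a # hs2) + L (hs1 @ b # hs2)"
    and "L (hs1 @ (c *\<^sub>R a) # hs2) = c *\<^sub>R L (hs1 @ a # hs2)"
  using assms unfolding multilinear_on_def by blast+

lemma multilinear_on_slice_deriv:
  assumes "multilinear_on (p + q) (D (p + q) (u, x))" "length hs = q"
  shows "multilinear_on p (slice_deriv D q u hs p x)"
proof -
  let ?i = "\<lambda>h. (h, 0)" and ?L = "D (p + q) (u, x)"
  have add: "?L (map (Pair 0) hs1 @ ((0, a) + (0, b)) # (map (Pair 0) hs2 @ map ?i hs))
       = ?L (map (Pair 0) hs1 @ (0, a) # (map (Pair 0) hs2 @ map ?i hs))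
       + ?L (map (Pair 0) hs1 @ (0, b) # (map (Pair 0) hs2 @ map ?i hs))"
    if "length hs1 + length hs2 + 1 = p" for hs1 hs2 a b
    by (rule multilinear_onD(1)[OF assms(1)]) (use that assms(2) in simp)
  have scale: "?L (map (Pair 0) hs1 @ (c *\<^sub>R (0, a)) # (map (Pair 0) hs2 @ map ?i hs))
       = c *\<^sub>R ?L (map (Pair 0) hs1 @ (0, a) # (map (Pair 0) hs2 @ map ?i hs))"
    if "length hs1 + length hs2 + 1 = p" for hs1 hs2 a c
    by (rule multilinear_onD(2)[OF assms(1)]) (use that assms(2) in simp)
  show ?thesis
    unfolding multilinear_on_def slice_deriv_def using add scale by simp
qed

text \<open>The values are compared as total functions of x, so multilinearity of \<open>D q\<close>
  is required at every point.\<close>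

lemma multilinear_on_slice:
  fixes D :: "nat \<Rightarrow> 'u::real_normed_vector \<times> 'v::real_normed_vector \<Rightarrow> ('u \<times> 'v) list \<Rightarrow> 'z::real_vector"
  assumes "\<And>p. multilinear_on q (D q p)"
  shows "multilinear_on q (slice D q u)"
proof -
  let ?i = "\<lambda>h. (h, 0)"
  have add: "D q (u, x) (map ?i hs1 @ ((a, 0) + (b, 0)) # map ?i hs2)
       = D q (u, x) (map ?i hs1 @ (a, 0) # map ?i hs2) + D q (u, x) (map ?i hs1 @ (b, 0) # map ?i hs2)"
    if "length hs1 + length hs2 + 1 = q" for hs1 hs2 a b x
    by (rule multilinear_onD(1)[OF assms]) (use that in simp)
  have scale: "D q (u, x) (map ?i hs1 @ (c *\<^sub>R (a, 0)) # map ?i hs2)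
       = c *\<^sub>R D q (u, x) (map ?i hs1 @ (a, 0) # map ?i hs2)"
    if "length hs1 + length hs2 + 1 = q" for hs1 hs2 a c x
    by (rule multilinear_onD(2)[OF assms]) (use that in simp)
  show ?thesis
    unfolding multilinear_on_def slice_def using add scale
    by (simp add: fun_eq_iff plus_fun_def scaleR_fun_def)
qed

lemma open_norm:
  fixes W :: "'w::real_normed_vector set"
  assumes "open W" "x \<in> W"
  shows "\<exists>\<delta>>0. \<forall>h. norm h < \<delta> \<longrightarrow> x + h \<in> W"
proof -
  obtain e where "0 < e" "ball x e \<subseteq> W" using assms openE by blast
  moreover have "x + h \<in> ball x e" if "norm h < e" for h using that by (simp add: dist_norm)
  ultimately show ?thesis by blast
qed

locale product_domain =
  fixes U :: "'u::real_normed_vector set" and V :: "'v::real_normed_vector set"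
    and target :: "'z::real_normed_vector itself"
  assumes open_U: "open U" and convex_U: "convex U" and open_V: "open V" and convex_V: "convex V"
begin

sublocale V: normed_target norm V target
  by unfold_locales (use open_norm[OF open_V] convex_V in \<open>auto simp: norm_triangle_ineq\<close>)

sublocale UV: normed_target max_norm "U \<times> V" target
proof unfold_locales
  fix p :: "'u \<times> 'v" assume p: "p \<in> U \<times> V"
  obtain d e where "0 < d" "\<And>h. norm h < d \<Longrightarrow> fst p + h \<in> U" "0 < e" "\<And>h. norm h < e \<Longrightarrow> snd p + h \<in> V"
    using open_norm[OF open_U, of "fst p"] open_norm[OF open_V, of "snd p"] p by auto
  thus "\<exists>\<delta>>0. \<forall>h. max_norm h < \<delta> \<longrightarrow> p + h \<in> U \<times> V"
    by (intro exI[of _ "min d e"]) (auto simp: max_norm_def mem_Times_iff)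
next
  fix x y :: "'u \<times> 'v"
  show "max_norm (x + y) \<le> max_norm x + max_norm y"
    using norm_triangle_ineq[of "fst x" "fst y"] norm_triangle_ineq[of "snd x" "snd y"]
    unfolding max_norm_def fst_add snd_add by linarith
next
  fix c and x :: "'u \<times> 'v"
  show "max_norm (c *\<^sub>R x) = \<bar>c\<bar> * max_norm x"
    by (simp add: max_norm_def max_mult_distrib_left)
qed (auto simp: max_norm_def prod_eq_iff max_def convex_Times convex_U convex_V norm_triangle_ineq split: if_splits)

end

section \<open>The slices as elements of C^s(V;Z)\<close>

locale product_family =
  product_domain U V "TYPE('z::real_normed_vector)" + Cr_family max_norm "U \<times> V" \<delta>1 r B \<phi> D
  for U :: "'u::real_normed_vector set" and V :: "'v::real_normed_vector set"
    and \<delta>1 r B and \<phi> :: "'u \<times> 'v \<Rightarrow> 'z::real_normed_vector" and D +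
  fixes s t :: real
  assumes s_nonneg: "0 \<le> s" and t_eq: "t = r - s" and t_pos: "0 < t"
begin

lemma \<gamma>: "0 < ord_alpha t" "ord_alpha t \<le> 1"
  using ord_alpha_bounds[OF t_pos] .

lemma \<beta>: "0 \<le> ord_alpha s" "ord_alpha s \<le> 1"
  using ord_alpha_bounds[of s] s_nonneg by (cases "s = 0"; simp add: ord_alpha_def)+

lemma exponents: "real (ord_k s) + ord_alpha s + (real (ord_k t) + ord_alpha t) = r"
  using ord_decomp[of s] ord_decomp[of t] t_eq by simp

text \<open>With \<open>r = k + \<alpha>\<close>, the sum of the two orders is
  \<open>k + \<alpha> - \<beta> - \<gamma>\<close>, which is below \<open>k + 1\<close> because
  \<alpha> is at most 1 and \<gamma> is positive.\<close>

lemma orders: "ord_k s + ord_k t \<le> ord_k r"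
proof -
  have "real (ord_k s + ord_k t) < real (ord_k r + 1)"
    using exponents \<gamma> \<beta> ord_decomp[of r] ord_alpha_bounds[OF r_pos] by simp
  thus ?thesis by linarith
qed

abbreviation "CsV \<equiv> Cr \<delta>1 norm (UNIV :: 'z set) norm V s"
abbreviation "NsV \<equiv> Cr_norm \<delta>1 norm (UNIV :: 'z set) norm V s"
abbreviation "PN \<equiv> \<lambda>hs. prod_list (map norm hs)"

text \<open>This is the differentiability of \<open>D\<close> along increments
  \<open>(0, h)\<close>. New V-directions enter at the front, so no symmetry is involved.\<close>

lemma slice_hders:
  assumes u: "u \<in> U" and hs: "length hs = q" and k: "q + l \<le> ord_k r"
  shows "V.hders l (slice D q u hs) (slice_deriv D q u hs)"
  unfolding V.higher_derivs_iff
proof (intro conjI allI ballI impI)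
  show "slice_deriv D q u hs 0 x [] = slice D q u hs x" if "x \<in> V" for x
    by (simp add: slice_deriv_def slice_def)
next
  let ?i = "\<lambda>h. (h, 0::'v)"
  fix p x assume p: "p \<le> l" and x: "x \<in> V"
  have "bounded_ml max_norm UNIV norm (p + q) (D (p + q) (u, x))"
    using p k u x by (intro UV.hders_ml[OF D]) auto
  hence ml: "multilinear_on (p + q) (D (p + q) (u, x))"
    and b: "ml_bounds max_norm norm (p + q) (D (p + q) (u, x)) \<noteq> {}"
    by (auto simp: bounded_ml_def)
  obtain C where C: "0 \<le> C" "\<And>hs. length hs = p + q \<Longrightarrow> norm (D (p + q) (u, x) hs) \<le> C * UV.P hs"
    using b by (auto simp: ml_bounds_def)
  have "norm (slice_deriv D q u hs p x ks) \<le> (C * PN hs) * PN ks" if "length ks = p" for ks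
    using C(2)[of "map (Pair 0) ks @ map ?i hs"] that hs
    by (simp add: slice_deriv_def comp_def mult_ac)
  hence "C * PN hs \<in> ml_bounds norm norm p (slice_deriv D q u hs p x)"
    using C V.Na_nonneg by (auto simp: ml_bounds_def intro!: mult_nonneg_nonneg prod_list_nonneg)
  thus "bounded_ml norm UNIV norm p (slice_deriv D q u hs p x)"
    using multilinear_on_slice_deriv[of p q D u x, OF ml hs] by (auto simp: bounded_ml_UNIV_iff)
next
  let ?i = "\<lambda>h. (h, 0::'v)"
  fix p x and \<epsilon> :: real assume p: "p < l" and x: "x \<in> V" and \<epsilon>: "0 < \<epsilon>"
  have P0: "0 \<le> PN hs" by (auto intro!: prod_list_nonneg)
  \<comment> \<open>The fixed U-directions contribute the constant factor \<open>PN hs\<close>,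
    absorbed here.\<close>
  define e where "e = \<epsilon> / (PN hs + 1)"
  have e: "0 < e" using \<epsilon> P0 by (simp add: e_def)
  have e': "e * PN hs \<le> \<epsilon>" using \<epsilon> P0 by (simp add: e_def field_simps)
  have pq: "p + q < ord_k r" and ux: "(u, x) \<in> U \<times> V" using p k u x by auto
  obtain d where d: "0 < d" "\<And>h hs. max_norm h < d \<Longrightarrow> (u, x) + h \<in> U \<times> V \<Longrightarrow> length hs = p + q \<Longrightarrow>
      norm (D (p + q) ((u, x) + h) hs - D (p + q) (u, x) hs - D (Suc (p + q)) (u, x) (h # hs))
        \<le> e * max_norm h * UV.P hs"
    using UV.hders_deriv[OF D pq ux e] by blast
  show "\<exists>\<delta>>0. \<forall>h. norm h < \<delta> \<and> x + h \<in> V \<longrightarrow> (\<forall>ks. length ks = p \<longrightarrow>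
      norm (slice_deriv D q u hs p (x + h) ks - slice_deriv D q u hs p x ks
         - slice_deriv D q u hs (Suc p) x (h # ks)) \<le> \<epsilon> * norm h * PN ks)"
  proof (intro exI[of _ d] conjI allI impI)
    fix h and ks :: "'v list" assume h: "norm h < d \<and> x + h \<in> V" and ks: "length ks = p"
    have "norm (slice_deriv D q u hs p (x + h) ks - slice_deriv D q u hs p x ks
         - slice_deriv D q u hs (Suc p) x (h # ks)) \<le> e * norm h * (PN ks * PN hs)"
      using d(2)[of "(0, h)" "map (Pair 0) ks @ map ?i hs"] h u ks hs
      by (simp add: slice_deriv_def comp_def)
    also have "\<dots> = (e * PN hs) * (norm h * PN ks)" by (simp add: mult_ac)
    also have "\<dots> \<le> \<epsilon> * (norm h * PN ks)"
      using e' by (intro mult_right_mono) (auto intro!: mult_nonneg_nonneg prod_list_nonneg)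
    finally show "norm (slice_deriv D q u hs p (x + h) ks - slice_deriv D q u hs p x ks
         - slice_deriv D q u hs (Suc p) x (h # ks)) \<le> \<epsilon> * norm h * PN ks" by (simp add: mult.assoc)
  qed (rule d)
qed

lemma PN_nonneg: "0 \<le> prod_list (map norm hs)"
  by (auto intro!: prod_list_nonneg)

lemma slice_Cbound:
  assumes u: "u \<in> U" and hs: "length hs = q" and q: "q \<le> ord_k t"
  shows "V.Cbound \<delta>1 s (slice_deriv D q u hs) (B * PN hs)"
  unfolding V.Cbound_def
proof (intro conjI allI ballI impI)
  let ?i = "\<lambda>h. (h, 0::'v)"
  fix p x and ks :: "'v list" assume *: "p \<le> ord_k s" "x \<in> V" "length ks = p"
  show "norm (slice_deriv D q u hs p x ks) \<le> B * PN hs * PN ks"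
    using norm_D_le[of "p + q" "(u, x)" "map (Pair 0) ks @ map ?i hs"] * u hs q orders
    by (simp add: slice_deriv_def comp_def mult_ac)
next
  let ?i = "\<lambda>h. (h, 0::'v)"
  fix x y and ks :: "'v list"
  assume *: "s \<noteq> 0" "x \<in> V" "y \<in> V" "norm (x - y) \<le> \<delta>1" "length ks = ord_k s"
  show "norm (slice_deriv D q u hs (ord_k s) x ks - slice_deriv D q u hs (ord_k s) y ks)
      \<le> B * PN hs * norm (x - y) powr ord_alpha s * PN ks"
    using D_hoelder[of "ord_k s + q" "ord_alpha s" "(u, x)" "(u, y)" "map (Pair 0) ks @ map ?i hs"]
      * u hs q orders exponents \<gamma> \<beta>
    by (simp add: slice_deriv_def comp_def mult_ac)
qed

lemma slice_Cr:
  assumes u: "u \<in> U" and hs: "length hs = q" and q: "q \<le> ord_k t"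
  shows "slice D q u hs \<in> CsV"
proof (rule V.CrI')
  show "V.hders (ord_k s) (slice D q u hs) (slice_deriv D q u hs)"
    using q orders by (intro slice_hders u hs) simp
  show "V.Cbound \<delta>1 s (slice_deriv D q u hs) (B * PN hs)" by (rule slice_Cbound) fact+
  show nn: "0 \<le> B * PN hs" by (simp add: B_nonneg PN_nonneg)
  \<comment> \<open>For \<open>s = 0\<close> the target demands continuity; it comes from the
    Hoelder condition of order \<open>ord_alpha t\<close>, which is positive.\<close>
  show "V.cont (slice D q u hs)"
  proof (intro ballI allI impI)
    fix x and \<epsilon> :: real assume x: "x \<in> V" and \<epsilon>: "0 < \<epsilon>"
    obtain \<delta> where \<delta>: "0 < \<delta>" "\<delta> \<le> \<delta>1" "\<And>a. 0 \<le> a \<Longrightarrow> a < \<delta> \<Longrightarrow> B * PN hs * a powr ord_alpha t < \<epsilon>"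
      using small_powr[OF nn \<gamma>(1) \<epsilon> \<delta>1(1)] by blast
    show "\<exists>\<delta>>0. \<forall>y\<in>V. norm (y - x) < \<delta> \<longrightarrow> norm (slice D q u hs y - slice D q u hs x) < \<epsilon>"
    proof (intro exI[of _ \<delta>] conjI ballI impI \<delta>)
      fix y assume y: "y \<in> V" "norm (y - x) < \<delta>"
      have "norm (slice D q u hs y - slice D q u hs x) \<le> B * norm (y - x) powr ord_alpha t * PN hs"
        using D_hoelder[of q "ord_alpha t" "(u, y)" "(u, x)" "map (\<lambda>h. (h, 0)) hs"]
          x y u hs q orders exponents \<gamma> \<beta> \<delta>
        by (simp add: slice_def comp_def)
      also have "\<dots> < \<epsilon>" using \<delta>(3)[OF norm_ge_zero y(2)] by (simp add: mult_ac)
      finally show "norm (slice D q u hs y - slice D q u hs x) < \<epsilon>" .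
    qed
  qed
qed

lemma slice_norm_le:
  assumes u: "u \<in> U" and hs: "length hs = q" and q: "q \<le> ord_k t"
  shows "NsV (slice D q u hs) \<le> B * PN hs"
proof (rule V.Cr_norm_le)
  show "V.hders (ord_k s) (slice D q u hs) (slice_deriv D q u hs)"
    using q orders by (intro slice_hders u hs) simp
  show "V.Cbound \<delta>1 s (slice_deriv D q u hs) (B * PN hs)" by (rule slice_Cbound) fact+
  show "0 \<le> B * PN hs" by (simp add: B_nonneg PN_nonneg)
qed

text \<open>The Hoelder condition in u of the top derivative. Sup norms of the x-derivatives use
  \<open>D_hoelder\<close> with exponent \<gamma>; the Hoelder seminorm in x uses
  \<open>double_difference\<close> at order \<open>ord_k s + ord_k t\<close>.\<close>

lemma slice_difference_norm_le:
  assumes u: "u \<in> U" "u' \<in> U" "norm (u - u') \<le> \<delta>1" and hs: "length hs = ord_k t"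
  shows "NsV (\<lambda>x. slice D (ord_k t) u hs x - slice D (ord_k t) u' hs x)
    \<le> 2 * B * norm (u - u') powr ord_alpha t * PN hs" (is "_ \<le> ?K")
proof (rule V.Cr_norm_le)
  let ?i = "\<lambda>h. (h, 0::'v)" and ?m = "ord_k t" and ?l = "ord_k s"
  let ?E = "\<lambda>p x ks. slice_deriv D ?m u hs p x ks - slice_deriv D ?m u' hs p x ks"
  show "V.hders ?l (\<lambda>x. slice D ?m u hs x - slice D ?m u' hs x) ?E"
    using orders by (intro V.hders_diff slice_hders u hs) simp_all
  show nn: "0 \<le> ?K" by (simp add: B_nonneg PN_nonneg)
  show "V.Cbound \<delta>1 s ?E ?K"
    unfolding V.Cbound_def
  proof (intro conjI allI ballI impI)
    fix p x and ks :: "'v list" assume *: "p \<le> ?l" "x \<in> V" "length ks = p"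
    \<comment> \<open>A single difference costs \<open>B\<close> rather than \<open>2 * B\<close>,
      hence half of \<open>?K\<close>.\<close>
    have "norm (?E p x ks) \<le> (?K * PN ks) / 2"
      using D_hoelder[of "p + ?m" "ord_alpha t" "(u, x)" "(u', x)" "map (Pair 0) ks @ map ?i hs"]
        * u hs orders exponents \<gamma> \<beta>
      by (simp add: slice_deriv_def comp_def mult_ac)
    also have "\<dots> \<le> ?K * PN ks" using mult_nonneg_nonneg[OF nn PN_nonneg[of ks]] by linarith
    finally show "norm (?E p x ks) \<le> ?K * PN ks" .
  next
    fix x y and ks :: "'v list"
    assume *: "s \<noteq> 0" "x \<in> V" "y \<in> V" "norm (x - y) \<le> \<delta>1" "length ks = ?l"
    \<comment> \<open>The corners of the parallelogram pair \<open>u\<close>, \<open>u'\<close> with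
      \<open>x\<close>, \<open>y\<close>; its base is \<open>(u', y)\<close>.\<close>
    show "norm (?E ?l x ks - ?E ?l y ks) \<le> ?K * norm (x - y) powr ord_alpha s * PN ks"
      using double_difference[of "?l + ?m" "ord_alpha s" "ord_alpha t" "(u', y)" "(u - u', 0)" "(0, x - y)"
          "map (Pair 0) ks @ map ?i hs"] * u hs orders exponents \<gamma> \<beta>
      by (simp add: slice_deriv_def comp_def mult_ac)
  qed
qed

text \<open>This is where symmetry enters: the new U-direction, placed behind the V-directions by
  \<open>slice_deriv\<close>, is moved to the front, where the Taylor estimates expect it.\<close>

lemma slice_deriv_Suc:
  assumes "u \<in> U" "x \<in> V" "length ks = p" "length hs = q" "p + q < ord_k r"
  shows "slice_deriv D (Suc q) u (h # hs) p x ks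
       = D (Suc (p + q)) (u, x) ((h, 0) # map (Pair 0) ks @ map (\<lambda>h. (h, 0)) hs)"
  using symmetric_front[of "map (Pair 0) ks" "map (\<lambda>h. (h, 0)) hs" "(u, x)" "(h, 0)"] assms
  by (simp add: slice_deriv_def)

text \<open>Differentiability in u with respect to the norm of C^s(V;Z):
  \<open>taylor_remainder\<close> bounds the x-derivatives uniformly, and
  \<open>taylor_remainder_difference\<close> bounds the top Hoelder seminorm.\<close>

lemma slice_remainder_norm_le:
  assumes u: "u \<in> U" "u + h \<in> U" "norm h \<le> \<delta>1" and hs: "length hs = q" and q: "q < ord_k t"
  shows "NsV (\<lambda>x. (slice D q (u + h) hs x - slice D q u hs x) - slice D (Suc q) u (h # hs) x)
    \<le> 2 * B * norm h powr ord_alpha t * norm h * PN hs" (is "_ \<le> ?K")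
proof (rule V.Cr_norm_le)
  let ?i = "\<lambda>h. (h, 0::'v)" and ?l = "ord_k s"
  let ?E = "\<lambda>p x ks. (slice_deriv D q (u + h) hs p x ks - slice_deriv D q u hs p x ks)
      - slice_deriv D (Suc q) u (h # hs) p x ks"
  show "V.hders ?l (\<lambda>x. (slice D q (u + h) hs x - slice D q u hs x) - slice D (Suc q) u (h # hs) x) ?E"
    using orders q hs by (intro V.hders_diff slice_hders u hs) simp_all
  show nn: "0 \<le> ?K" by (simp add: B_nonneg PN_nonneg)
  \<comment> \<open>Since \<open>q + 1\<close> is at most \<open>ord_k t\<close>, there is room for
    one more derivative together with both exponents.\<close>
  have lq: "real ?l + real q + 1 + ord_alpha s + ord_alpha t \<le> r"
    using q exponents by linarith
  show "V.Cbound \<delta>1 s ?E ?K"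
    unfolding V.Cbound_def
  proof (intro conjI allI ballI impI)
    fix p x and ks :: "'v list" assume *: "p \<le> ?l" "x \<in> V" "length ks = p"
    have pq: "p + q < ord_k r" using * q orders by simp
    have "norm (?E p x ks) \<le> (?K * PN ks) / 2"
      unfolding slice_deriv_Suc[OF u(1) *(2,3) hs pq]
      using taylor_remainder[of "p + q" "ord_alpha t" "(u, x)" "(h, 0)" "map (Pair 0) ks @ map ?i hs"]
        * u hs pq lq \<gamma> \<beta>
      by (simp add: slice_deriv_def comp_def mult_ac)
    also have "\<dots> \<le> ?K * PN ks" using mult_nonneg_nonneg[OF nn PN_nonneg[of ks]] by linarith
    finally show "norm (?E p x ks) \<le> ?K * PN ks" .
  next
    fix x y and ks :: "'v list"
    assume *: "s \<noteq> 0" "x \<in> V" "y \<in> V" "norm (x - y) \<le> \<delta>1" "length ks = ?l"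
    have pq: "?l + q < ord_k r" using * q orders by simp
    show "norm (?E ?l x ks - ?E ?l y ks) \<le> ?K * norm (x - y) powr ord_alpha s * PN ks"
      unfolding slice_deriv_Suc[OF u(1) *(2,5) hs pq] slice_deriv_Suc[OF u(1) *(3,5) hs pq]
      using taylor_remainder_difference[of "?l + q" "ord_alpha s" "ord_alpha t" "(u, y)" "(h, 0)" "(0, x - y)"
          "map (Pair 0) ks @ map ?i hs"] * u hs pq lq \<gamma> \<beta>
      by (simp add: slice_deriv_def comp_def mult_ac)
  qed
qed

section \<open>The curried map and its derivatives\<close>

sublocale CsV: hoelder_space norm CsV NsV U
  by unfold_locales
    (use V.Cr_space[where \<delta> = \<delta>1 and r = s] open_norm[OF open_U] in \<open>auto simp: norm_triangle_ineq\<close>)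

text \<open>Both hypotheses concern all points, also off \<open>U \<times> V\<close>, since the
  values of the curried map are total functions of x; \<open>hders_normalize\<close> provides
  them.\<close>

lemma slice_higher_derivs:
  assumes D0: "\<And>p. D 0 p [] = \<phi> p" and ml: "\<And>q p. q \<le> ord_k r \<Longrightarrow> multilinear_on q (D q p)"
  shows "CsV.hders (ord_k t) (curry_hat \<phi>) (slice D)"
  unfolding CsV.higher_derivs_iff
proof (intro conjI allI ballI impI)
  show "slice D 0 u [] = curry_hat \<phi> u" for u
    by (simp add: slice_def curry_hat_def D0)
next
  fix q u assume q: "q \<le> ord_k t" and u: "u \<in> U"
  have "B \<in> ml_bounds norm NsV q (slice D q u)"
    using slice_norm_le[OF u _ q] B_nonneg by (auto simp: ml_bounds_def)
  moreover have "multilinear_on q (slice D q u)"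
    using q orders by (intro multilinear_on_slice ml) simp
  ultimately show "bounded_ml norm CsV NsV q (slice D q u)"
    using slice_Cr[OF u _ q] by (auto simp: bounded_ml_def)
next
  fix q u and \<epsilon> :: real assume q: "q < ord_k t" and u: "u \<in> U" and \<epsilon>: "0 < \<epsilon>"
  \<comment> \<open>Positivity of \<gamma> makes the remainder bound
    \<open>2 * B * norm h powr \<gamma> * norm h\<close> of order o(|h|).\<close>
  obtain \<delta> where \<delta>: "0 < \<delta>" "\<delta> \<le> \<delta>1" "\<And>a. 0 \<le> a \<Longrightarrow> a < \<delta> \<Longrightarrow> 2 * B * a powr ord_alpha t < \<epsilon>"
    using small_powr[OF _ \<gamma>(1) \<epsilon> \<delta>1(1), of "2 * B"] B_nonneg by auto
  show "\<exists>\<delta>>0. \<forall>h. norm h < \<delta> \<and> u + h \<in> U \<longrightarrow> (\<forall>hs. length hs = q \<longrightarrow>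
      NsV (slice D q (u + h) hs - slice D q u hs - slice D (Suc q) u (h # hs)) \<le> \<epsilon> * norm h * PN hs)"
  proof (intro exI[of _ \<delta>] conjI allI impI \<delta>)
    fix h and hs :: "'u list" assume h: "norm h < \<delta> \<and> u + h \<in> U" and hs: "length hs = q"
    have "NsV (slice D q (u + h) hs - slice D q u hs - slice D (Suc q) u (h # hs))
       \<le> 2 * B * norm h powr ord_alpha t * (norm h * PN hs)"
      using slice_remainder_norm_le[OF u _ _ hs q, of h] h \<delta>(2) by (simp add: fun_diff_def mult.assoc)
    also have "\<dots> \<le> \<epsilon> * (norm h * PN hs)"
      using \<delta>(3)[of "norm h"] h PN_nonneg
      by (intro mult_right_mono mult_nonneg_nonneg) auto
    finally show "NsV (slice D q (u + h) hs - slice D q u hs - slice D (Suc q) u (h # hs))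
       \<le> \<epsilon> * norm h * PN hs" by (simp add: mult.assoc)
  qed
qed

text \<open>The factor 2 stems from \<open>double_difference\<close> and becomes the bound for the
  norm of the embedding.\<close>

lemma slice_family_Cbound: "CsV.Cbound \<delta>1 t (slice D) (2 * B)"
  unfolding CsV.Cbound_def
proof (intro conjI allI ballI impI)
  fix q u and hs :: "'u list" assume *: "q \<le> ord_k t" "u \<in> U" "length hs = q"
  have "NsV (slice D q u hs) \<le> B * PN hs" by (rule slice_norm_le) fact+
  also have "\<dots> \<le> 2 * B * PN hs" using B_nonneg by (intro mult_right_mono PN_nonneg) simp
  finally show "NsV (slice D q u hs) \<le> 2 * B * PN hs" .
next
  fix u u' and hs :: "'u list"
  assume *: "u \<in> U" "u' \<in> U" "norm (u - u') \<le> \<delta>1" "length hs = ord_k t"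
  show "NsV (slice D (ord_k t) u hs - slice D (ord_k t) u' hs)
     \<le> 2 * B * norm (u - u') powr ord_alpha t * PN hs"
    using slice_difference_norm_le[OF *] by (simp add: fun_diff_def)
qed

lemma curry_hat_Cr:
  assumes D0: "\<And>p. D 0 p [] = \<phi> p" and ml: "\<And>q p. q \<le> ord_k r \<Longrightarrow> multilinear_on q (D q p)"
  shows "curry_hat \<phi> \<in> Cr \<delta>1 norm CsV NsV U t"
    and "Cr_norm \<delta>1 norm CsV NsV U t (curry_hat \<phi>) \<le> 2 * B"
proof -
  note h = slice_higher_derivs[OF assms]
  have nn: "0 \<le> 2 * B" using B_nonneg by simp
  show "curry_hat \<phi> \<in> Cr \<delta>1 norm CsV NsV U t"
    using t_pos by (intro CsV.CrI[OF _ h slice_family_Cbound nn]) simp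
  show "Cr_norm \<delta>1 norm CsV NsV U t (curry_hat \<phi>) \<le> 2 * B"
    by (rule CsV.Cr_norm_le[OF h slice_family_Cbound nn])
qed

text \<open>Norm 0 descends twice, first to \<open>NsV\<close> of each slice and then to its values.
  The norms ignore points off the domain, so the conclusion concerns
  \<open>U \<times> V\<close>.\<close>

lemma curry_hat_norm_0:
  assumes D0: "\<And>p. D 0 p [] = \<phi> p" and ml: "\<And>q p. q \<le> ord_k r \<Longrightarrow> multilinear_on q (D q p)"
    and 0: "Cr_norm \<delta>1 norm CsV NsV U t (curry_hat \<phi>) = 0" and p: "p \<in> U \<times> V"
  shows "\<phi> p = 0"
proof -
  obtain u x where ux: "p = (u, x)" "u \<in> U" "x \<in> V" using p by auto
  note h = slice_higher_derivs[OF D0 ml]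
  have N: "NsV (slice D 0 u []) \<le> 0"
    using CsV.CboundD(1)[OF CsV.Cbound_Cr_norm[OF curry_hat_Cr(1)[OF D0 ml] h], of 0 u "[]"] ux 0 by simp
  have "V.hders (ord_k s) (slice D 0 u []) (slice_deriv D 0 u [])"
    using orders by (intro slice_hders ux) auto
  from V.CboundD(1)[OF V.Cbound_Cr_norm[OF slice_Cr[OF ux(2), of "[]" 0] this], of 0 x "[]"]
  have "norm (D 0 (u, x) []) \<le> NsV (slice D 0 u [])" using ux by (simp add: slice_deriv_def)
  hence "norm (D 0 (u, x) []) \<le> 0" using N by linarith
  thus ?thesis using D0 ux by simp
qed

text \<open>Replacing the carrier changes neither \<open>NsV\<close> nor the estimates, so only the
  membership of the derivatives in \<open>S\<close> is left; it serves for c^s(V;Z).\<close>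

lemma curry_hat_Cr_subspace:
  assumes D0: "\<And>p. D 0 p [] = \<phi> p" and ml: "\<And>q p. q \<le> ord_k r \<Longrightarrow> multilinear_on q (D q p)"
    and S: "\<And>q u hs. q \<le> ord_k t \<Longrightarrow> u \<in> U \<Longrightarrow> length hs = q \<Longrightarrow> slice D q u hs \<in> S"
  shows "curry_hat \<phi> \<in> Cr \<delta>1 norm S NsV U t"
proof -
  note h = slice_higher_derivs[OF D0 ml]
  have t0: "t \<noteq> 0" using t_pos by simp
  have "higher_derivs norm S NsV U (ord_k t) (curry_hat \<phi>) (slice D)"
    using h S unfolding higher_derivs_def bounded_ml_def by simp
  moreover have "curry_hat \<phi> u \<in> S" if "u \<in> U" for u
    using S[OF _ that, of 0 "[]"] CsV.hders_0[OF h that] by simp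
  ultimately show ?thesis
    using t0 CsV.Cr_bdd[OF curry_hat_Cr(1)[OF D0 ml] t0 h] by (auto simp: Cr_def)
qed

end

section \<open>Little Hoelder spaces\<close>

context product_domain
begin

text \<open>For fixed \<open>u\<close> and \<open>hs\<close>, slicing is bounded from the norm of
  order r to that of order s, so approximations carry over. All orders up to \<open>ord_k t\<close>
  are covered, since the derivatives must also take values in c^s(V;Z).\<close>

lemma slice_cr:
  fixes \<phi> :: "'u \<times> 'v \<Rightarrow> 'z"
  assumes \<delta>1: "0 < \<delta>1" "\<delta>1 \<le> 1" and rst: "0 \<le> s" "t = r - s" "0 < t"
    and \<phi>: "\<phi> \<in> cr \<delta>1 max_norm UNIV norm (U \<times> V) r"
    and D: "UV.hders (ord_k r) \<phi> D"
    and q: "q \<le> ord_k t" and u: "u \<in> U" and hs: "length hs = q"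
  shows "slice D q u hs \<in> cr \<delta>1 norm (UNIV :: 'z set) norm V s"
proof -
  let ?Cr = "Cr \<delta>1 max_norm (UNIV :: 'z set) norm (U \<times> V)"
  let ?N = "Cr_norm \<delta>1 max_norm (UNIV :: 'z set) norm (U \<times> V) r"
  let ?PN = "prod_list (map norm hs)"
  have r: "0 < r" using rst by simp
  have \<phi>r: "\<phi> \<in> ?Cr r" using \<phi> by (simp add: cr_def)
  have PN: "0 \<le> ?PN" by (auto intro!: prod_list_nonneg)
  interpret \<phi>: product_family U V \<delta>1 r "?N \<phi>" \<phi> D s t
    by unfold_locales
      (use \<delta>1 rst r D UV.Cbound_Cr_norm[OF \<phi>r D] UV.Cr_norm_nonneg[OF \<phi>r] in auto)
  show ?thesis
    unfolding cr_def
  proof (intro CollectI conjI allI impI)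
    show "slice D q u hs \<in> Cr \<delta>1 norm UNIV norm V s" by (rule \<phi>.slice_Cr) fact+
    fix \<epsilon> :: real assume \<epsilon>: "0 < \<epsilon>"
    define e where "e = \<epsilon> / (?PN + 1)"
    have e: "0 < e" using \<epsilon> PN by (simp add: e_def)
    obtain r' \<Psi> where r': "r < r'" and \<Psi>: "\<Psi> \<in> ?Cr r'" "?N (\<lambda>x. \<phi> x - \<Psi> x) < e"
      using \<phi> e unfolding cr_def by blast
    obtain E where E: "UV.hders (ord_k r') \<Psi> E" using UV.Cr_hders_ex[OF \<Psi>(1)] .
    \<comment> \<open>\<open>t\<close> is kept and \<open>s\<close> raised by \<open>r' - r\<close>:
      the same orders \<open>q\<close> stay admissible and the slices of \<Psi> gain smoothness in
      x.\<close>
    interpret \<Psi>: product_family U V \<delta>1 r' "Cr_norm \<delta>1 max_norm UNIV norm (U \<times> V) r' \<Psi>" \<Psi> E "s + (r' - r)" t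
      by unfold_locales
        (use \<delta>1 rst r r' E UV.Cbound_Cr_norm[OF \<Psi>(1) E] UV.Cr_norm_nonneg[OF \<Psi>(1)] in auto)
    have d: "(\<lambda>x. \<phi> x - \<Psi> x) \<in> ?Cr r"
      using UV.Cr_lincomb(1)[OF \<phi>r \<Psi>.Cr_embed[of r], of 1 "-1"] r r' by simp
    \<comment> \<open>With \<open>D - E\<close> as the family for \<phi> - \<Psi>, slicing commutes
      with the difference.\<close>
    have dE: "UV.hders (ord_k r) (\<lambda>x. \<phi> x - \<Psi> x) (\<lambda>q x hs. D q x hs - E q x hs)"
      using r' by (intro UV.hders_diff D UV.hders_truncate[OF E] ord_k_mono) simp
    interpret d: product_family U V \<delta>1 r "?N (\<lambda>x. \<phi> x - \<Psi> x)" "\<lambda>x. \<phi> x - \<Psi> x"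
        "\<lambda>q x hs. D q x hs - E q x hs" s t
      by unfold_locales
        (use \<delta>1 rst r dE UV.Cbound_Cr_norm[OF d dE] UV.Cr_norm_nonneg[OF d] in auto)
    have "(\<lambda>x. slice D q u hs x - slice E q u hs x) = slice (\<lambda>q x hs. D q x hs - E q x hs) q u hs"
      by (simp add: slice_def)
    hence "Cr_norm \<delta>1 norm UNIV norm V s (\<lambda>x. slice D q u hs x - slice E q u hs x)
        \<le> ?N (\<lambda>x. \<phi> x - \<Psi> x) * ?PN"
      using d.slice_norm_le[OF u hs q] by simp
    also have "\<dots> \<le> e * ?PN" using \<Psi>(2) PN by (intro mult_right_mono) auto
    also have "\<dots> < \<epsilon>" using \<epsilon> PN by (simp add: e_def field_simps)
    finally show "\<exists>r'>s. \<exists>\<psi>\<in>Cr \<delta>1 norm UNIV norm V r'.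
        Cr_norm \<delta>1 norm UNIV norm V s (\<lambda>x. slice D q u hs x - \<psi> x) < \<epsilon>"
      using \<Psi>.slice_Cr[OF u hs q] r' by (intro exI[of _ "s + (r' - r)"] conjI bexI[of _ "slice E q u hs"]) auto
  qed
qed

lemma product_family_Cr:
  fixes \<phi> :: "'u \<times> 'v \<Rightarrow> 'z"
  assumes "0 < \<delta>1" "\<delta>1 \<le> 1" "0 \<le> s" "t = r - s" "0 < t"
    and \<phi>: "\<phi> \<in> Cr \<delta>1 max_norm UNIV norm (U \<times> V) r"
  obtains D where "product_family U V \<delta>1 r (Cr_norm \<delta>1 max_norm UNIV norm (U \<times> V) r \<phi>) \<phi> D s t"
    "\<And>p. D 0 p [] = \<phi> p" "\<And>q p. q \<le> ord_k r \<Longrightarrow> multilinear_on q (D q p)"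
    "UV.hders (ord_k r) \<phi> D"
proof -
  obtain D' where D': "UV.hders (ord_k r) \<phi> D'" using UV.Cr_hders_ex[OF \<phi>] .
  obtain D where D: "UV.hders (ord_k r) \<phi> D"
    "\<And>p. D 0 p [] = \<phi> p" "\<And>q p. q \<le> ord_k r \<Longrightarrow> multilinear_on q (D q p)"
    using UV.hders_normalize[OF D'] by metis
  have "product_family U V \<delta>1 r (Cr_norm \<delta>1 max_norm UNIV norm (U \<times> V) r \<phi>) \<phi> D s t"
    by unfold_locales (use assms D(1) UV.Cbound_Cr_norm[OF \<phi> D(1)] UV.Cr_norm_nonneg[OF \<phi>] in auto)
  thus ?thesis using D by (intro that)
qed

end

theorem theoremC2:
  fixes U :: "'u::banach set" and V :: "'v::banach set" and \<delta>1 r s t :: real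
  assumes "0 < \<delta>1" "\<delta>1 \<le> 1"
    and "open U" "convex U" "open V" "convex V"
    and "0 \<le> r" "0 \<le> s" "t = r - s" "0 < t"
  defines "CsV \<equiv> Cr \<delta>1 norm (UNIV :: 'z::banach set) norm V s"
    and "csV \<equiv> cr \<delta>1 norm (UNIV :: 'z set) norm V s"
    and "NsV \<equiv> Cr_norm \<delta>1 norm (UNIV :: 'z set) norm V s"
  shows
    "(\<forall>\<phi> \<in> Cr \<delta>1 max_norm UNIV norm (U \<times> V) r.
        curry_hat \<phi> \<in> Cr \<delta>1 norm CsV NsV U t)
     \<and> (\<forall>\<phi> \<in> Cr \<delta>1 max_norm UNIV norm (U \<times> V) r. \<forall>\<psi> \<in> Cr \<delta>1 max_norm UNIV norm (U \<times> V) r.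
          \<forall>a b. curry_hat (\<lambda>p. a *\<^sub>R (\<phi> :: 'u \<times> 'v \<Rightarrow> 'z) p + b *\<^sub>R \<psi> p) = a *\<^sub>R curry_hat \<phi> + b *\<^sub>R curry_hat \<psi>)
     \<and> (\<exists>C. \<forall>\<phi> \<in> Cr \<delta>1 max_norm UNIV norm (U \<times> V) r.
          Cr_norm \<delta>1 norm CsV NsV U t (curry_hat \<phi>)
            \<le> C * Cr_norm \<delta>1 max_norm UNIV norm (U \<times> V) r \<phi>)
     \<and> (\<forall>\<phi> \<in> Cr \<delta>1 max_norm UNIV norm (U \<times> V) r. \<forall>\<psi> \<in> Cr \<delta>1 max_norm UNIV norm (U \<times> V) r.
          Cr_norm \<delta>1 norm CsV NsV U t (\<lambda>u. curry_hat \<phi> u - curry_hat \<psi> u) = 0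
            \<longrightarrow> (\<forall>p \<in> U \<times> V. \<phi> p = \<psi> p))
     \<and> (\<forall>\<phi> \<in> cr \<delta>1 max_norm UNIV norm (U \<times> V) r.
        curry_hat \<phi> \<in> Cr \<delta>1 norm csV NsV U t)"
proof -
  interpret product_domain U V "TYPE('z)" by unfold_locales fact+
  let ?Cr = "Cr \<delta>1 max_norm (UNIV :: 'z set) norm (U \<times> V) r"
  let ?N = "Cr_norm \<delta>1 max_norm (UNIV :: 'z set) norm (U \<times> V) r"
  note family = product_family_Cr[OF assms(1,2,8-10)]
  have "curry_hat \<phi> \<in> Cr \<delta>1 norm CsV NsV U t \<and> Cr_norm \<delta>1 norm CsV NsV U t (curry_hat \<phi>) \<le> 2 * ?N \<phi>"
    if \<phi>: "\<phi> \<in> ?Cr" for \<phi>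
  proof -
    obtain D where D: "product_family U V \<delta>1 r (?N \<phi>) \<phi> D s t"
      "\<And>p. D 0 p [] = \<phi> p" "\<And>q p. q \<le> ord_k r \<Longrightarrow> multilinear_on q (D q p)"
      "UV.hders (ord_k r) \<phi> D"
      by (rule family[OF \<phi>], rule that)
    show ?thesis
      unfolding CsV_def NsV_def using product_family.curry_hat_Cr[OF D(1-3)] by blast
  qed
  moreover have "curry_hat (\<lambda>p. a *\<^sub>R (\<phi> :: 'u \<times> 'v \<Rightarrow> 'z) p + b *\<^sub>R \<psi> p) = a *\<^sub>R curry_hat \<phi> + b *\<^sub>R curry_hat \<psi>"
    for \<phi> \<psi> a b
    by (simp add: curry_hat_def fun_eq_iff plus_fun_def scaleR_fun_def)
  moreover have "\<phi> p = \<psi> p"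
    if \<phi>: "\<phi> \<in> ?Cr" and \<psi>: "\<psi> \<in> ?Cr" and p: "p \<in> U \<times> V"
      and 0: "Cr_norm \<delta>1 norm CsV NsV U t (\<lambda>u. curry_hat \<phi> u - curry_hat \<psi> u) = 0" for \<phi> \<psi> p
  proof -
    \<comment> \<open>By linearity, injectivity reduces to a trivial kernel, applied to the
      difference.\<close>
    have d: "(\<lambda>x. \<phi> x - \<psi> x) \<in> ?Cr" using UV.Cr_lincomb(1)[OF \<phi> \<psi>, of 1 "-1"] by simp
    have "curry_hat (\<lambda>x. \<phi> x - \<psi> x) = (\<lambda>u. curry_hat \<phi> u - curry_hat \<psi> u)"
      by (simp add: curry_hat_def fun_eq_iff)
    hence "Cr_norm \<delta>1 norm CsV NsV U t (curry_hat (\<lambda>x. \<phi> x - \<psi> x)) = 0" using 0 by simp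
    note norm_0 = this[unfolded CsV_def NsV_def]
    obtain D where D: "product_family U V \<delta>1 r (?N (\<lambda>x. \<phi> x - \<psi> x)) (\<lambda>x. \<phi> x - \<psi> x) D s t"
      "\<And>p. D 0 p [] = \<phi> p - \<psi> p" "\<And>q p. q \<le> ord_k r \<Longrightarrow> multilinear_on q (D q p)"
      "UV.hders (ord_k r) (\<lambda>x. \<phi> x - \<psi> x) D"
      by (rule family[OF d], rule that)
    have "\<phi> p - \<psi> p = 0" by (rule product_family.curry_hat_norm_0[OF D(1-3) norm_0 p])
    thus ?thesis by simp
  qed
  moreover have "curry_hat \<phi> \<in> Cr \<delta>1 norm csV NsV U t"
    if \<phi>: "\<phi> \<in> cr \<delta>1 max_norm (UNIV :: 'z set) norm (U \<times> V) r" for \<phi>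
  proof -
    have \<phi>r: "\<phi> \<in> ?Cr" using \<phi> by (simp add: cr_def)
    obtain D where D: "product_family U V \<delta>1 r (?N \<phi>) \<phi> D s t"
      "\<And>p. D 0 p [] = \<phi> p" "\<And>q p. q \<le> ord_k r \<Longrightarrow> multilinear_on q (D q p)"
      "UV.hders (ord_k r) \<phi> D"
      by (rule family[OF \<phi>r], rule that)
    show ?thesis
      unfolding NsV_def
    proof (rule product_family.curry_hat_Cr_subspace[OF D(1-3)])
      show "slice D q u hs \<in> csV" if "q \<le> ord_k t" "u \<in> U" "length hs = q" for q u hs
        unfolding csV_def by (rule slice_cr[OF assms(1,2,8-10) \<phi> D(4) that])
    qed
  qed
  ultimately show ?thesis by blast
qed

end
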